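(* Let $\alpha,\beta,\gamma,\rho,a\in\mathbb{C}$ with $\operatorname{Re}(\alpha)>0$ and $a\ne0$, and let $\mu$ be a real number, such that $\mu>0$ and $\operatorname{Re}(\rho)>\max\{\operatorname{Re}(-\alpha-\gamma),\operatorname{Re}(\beta)+[\operatorname{Re}(\alpha)]+1\}$. Then for every $x>0$, $$\left(\mathcal{D}_{-}^{\alpha,\beta,\gamma}\left(t^{-\rho}I^{m,n}_{p,q}\left[at^{-\mu}\,\middle|\begin{matrix}(a_i,A_i,\alpha_i)_{1,p}\\(b_j,B_j,\beta_j)_{1,q}\end{matrix}\right]\right)\right)(x)=x^{\beta-\rho}\,I^{m,n+2}_{p+2,q+2}\left[ax^{-\mu}\,\middle|\begin{matrix}(1+\beta-\rho,\mu,1),\ (1-\alpha-\gamma-\rho,\mu,1),\ (a_i,A_i,\alpha_i)_{1,p}\\(b_j,B_j,\beta_j)_{1,q},\ (1-\rho,\mu,1),\ (1+\beta-\gamma-\rho,\mu,1)\end{matrix}\right].$$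
   Context: **$I$-function.** Let $m,n,p,q$ be integers with $0\le m\le q$, $0\le n\le p$; let $a_i\in\mathbb{C}$, $A_i,\alpha_i>0$ $(1\le i\le p)$ and $b_j\in\mathbb{C}$, $B_j,\beta_j>0$ $(1\le j\le q)$. For $z\neq0$ (with a chosen value of $\arg z$; $z^{-s}=e^{-s(\log|z|+i\arg z)}$), $$I^{m,n}_{p,q}\left[z\,\middle|\begin{matrix}(a_i,A_i,\alpha_i)_{1,p}\\(b_j,B_j,\beta_j)_{1,q}\end{matrix}\right]=\frac{1}{2\pi i}\int_{C}\chi(s)z^{-s}\,ds,\qquad \chi(s)=\frac{\prod_{j=1}^{m}\Gamma^{\beta_j}(b_j+B_js)\prod_{i=1}^{n}\Gamma^{\alpha_i}(1-a_i-A_is)}{\prod_{j=m+1}^{q}\Gamma^{\beta_j}(1-b_j-B_js)\prod_{i=n+1}^{p}\Gamma^{\alpha_i}(a_i+A_is)}.$$ Here $(a_i,A_i,\alpha_i)_{1,p}$ is the ordered list of triples for $i=1,\dots,p$ (the first $n$ upper triples and the first $m$ lower triples enter the numerator), $\Gamma^{\kappa}(w)=(\Gamma(w))^{\kappa}$, with the branch of non-integer powers fixed along $C$ and the same for the same triple in all $I$-functions considered; empty products equal $1$. The singularities of $\Gamma^{\beta_j}(b_j+B_js)$, $j\le m$, lie to the left of $C$ and those of $\Gamma^{\alpha_i}(1-a_i-A_is)$, $i\le n$, to the right. **Standing assumptions.** The contour $C$ is the imaginary axis $\operatorname{Re}(s)=0$, traversed upwards, and for each $I$-function occurring the following conditions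 for absolute convergence hold: with (computed from the parameters of that $I$-function) $\mu^*=\sum_{j=1}^q\beta_jB_j-\sum_{i=1}^p\alpha_iA_i$, $\Omega=\sum_{i=1}^p(\frac12-\operatorname{Re}(a_i))\alpha_i-\sum_{j=1}^q(\frac12-\operatorname{Re}(b_j))\beta_j$, $\Delta=\sum_{j=1}^m\beta_jB_j-\sum_{j=m+1}^q\beta_jB_j+\sum_{i=1}^n\alpha_iA_i-\sum_{i=n+1}^p\alpha_iA_i$, either $\Delta>0$ and $|\arg z|<\frac{\pi}{2}\Delta$, or $\Delta\ge0$, $|\arg z|=\frac{\pi}{2}\Delta$ and one of: $\mu^*=0$ and $\Omega<-1$; or $\mu^*\ne0$ and $\Omega+\sigma\mu^*<-1$ where $\sigma=\operatorname{Re}(s)$ on $C$ (so $\sigma=0$). For $t>0$, $\arg(at^{\pm\mu})=\arg a$. **Operators.** For $\operatorname{Re}(\alpha)>0$, $x>0$, the right-sided Saigo fractional integral is $$\left(\mathcal{I}_{-}^{\alpha,\beta,\gamma}f\right)(x)=\frac{1}{\Gamma(\alpha)}\int_x^{\infty}(t-x)^{\alpha-1}t^{-\alpha-\beta}{}_{2}F_1\left(\alpha+\beta,-\gamma;\alpha;1-\tfrac{x}{t}\right)f(t)\,dt,$$ and the right-sided Saigo (generalized) fractional derivative is $$\left(\mathcal{D}_{-}^{\alpha,\beta,\gamma}f\right)(x)=\left(-\frac{d}{dx}\right)^{N}\left(\mathcal{I}_{-}^{-\alpha+N,-\beta-N,\alpha+\gamma}f\right)(x),\qquad N=[\operatorname{Re}(\alpha)]+1,$$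 with $[\cdot]$ the integer part. *)

theory Defs
  imports "HOL-Analysis.Analysis"
begin

text \<open>
  A parameter triple \<open>(a, A, \<alpha>)\<close> has a complex first entry and two real entries.  The upper
  triples form the list \<open>us\<close> and the lower ones the list \<open>ls\<close>, so that \<open>p = length us\<close> and
  \<open>q = length ls\<close>.
\<close>

type_synonym triple = "complex \<times> real \<times> real"

text \<open>
  Every factor of the integrand is \<open>\<Gamma>\<^sup>\<kappa>(c + d s)\<close> with \<open>\<kappa>\<close>, \<open>c\<close>, \<open>d\<close> read off
  from a triple and its role.  The branch of such a power along the contour \<open>Re s = 0\<close> is fixed
  by a continuous logarithm \<open>L \<kappa> c d\<close> of \<open>s \<mapsto> \<Gamma>(c + d s)\<close>.  A factor
  \<open>\<Gamma>(c + d s)\<close> of the denominator may have a pole on the contour; the logarithm is not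
  constrained there.
\<close>

definition gamma_log_branch :: "(real \<Rightarrow> complex \<Rightarrow> real \<Rightarrow> complex \<Rightarrow> complex) \<Rightarrow> bool" where
  "gamma_log_branch L \<longleftrightarrow>
     (\<forall>\<kappa> c d. let S = {s. Re s = 0 \<and> c + of_real d * s \<notin> \<int>\<^sub>\<le>\<^sub>0} in
        continuous_on S (L \<kappa> c d) \<and> (\<forall>s\<in>S. exp (L \<kappa> c d s) = Gamma (c + of_real d * s)))"

text \<open>
  The value \<open>0\<close> at a pole of \<open>\<Gamma>\<close> follows the library's convention for \<^const>\<open>Gamma\<close>; in a
  denominator it gives, because of \<open>1 / 0 = 0\<close>, the limit \<open>0\<close> of the reciprocal power.
\<close>

definition gamma_pow ::
  "(real \<Rightarrow> complex \<Rightarrow> real \<Rightarrow> complex \<Rightarrow> complex) \<Rightarrow> real \<Rightarrow> complex \<Rightarrow> real \<Rightarrow> complex \<Rightarrow> complex" where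
  "gamma_pow L \<kappa> c d s =
     (if c + of_real d * s \<in> \<int>\<^sub>\<le>\<^sub>0 then 0 else exp (of_real \<kappa> * L \<kappa> c d s))"

definition I_chi ::
  "(real \<Rightarrow> complex \<Rightarrow> real \<Rightarrow> complex \<Rightarrow> complex) \<Rightarrow> nat \<Rightarrow> nat \<Rightarrow> triple list \<Rightarrow> triple list \<Rightarrow> complex \<Rightarrow> complex"
  where
  "I_chi L m n us ls s =
     ((\<Prod>(b, B, \<beta>)\<leftarrow>take m ls. gamma_pow L \<beta> b B s) *
      (\<Prod>(a, A, \<alpha>)\<leftarrow>take n us. gamma_pow L \<alpha> (1 - a) (- A) s)) /
     ((\<Prod>(b, B, \<beta>)\<leftarrow>drop m ls. gamma_pow L \<beta> (1 - b) (- B) s) *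
      (\<Prod>(a, A, \<alpha>)\<leftarrow>drop n us. gamma_pow L \<alpha> a A s))"

text \<open>
  \<open>\<theta>\<close> is the chosen value of \<open>arg z\<close>, not necessarily the principal one.  The contour is
  parametrised by \<open>s = \<i> y\<close>, whence the factor \<open>ds/dy = \<i>\<close>.
\<close>

definition I_fun ::
  "(real \<Rightarrow> complex \<Rightarrow> real \<Rightarrow> complex \<Rightarrow> complex) \<Rightarrow> nat \<Rightarrow> nat \<Rightarrow> triple list \<Rightarrow> triple list \<Rightarrow>
   real \<Rightarrow> complex \<Rightarrow> complex" where
  "I_fun L m n us ls \<theta> z =
     1 / (2 * of_real pi * \<i>) *
     (LINT y|lborel. I_chi L m n us ls (\<i> * of_real y) *
        exp (- (\<i> * of_real y) * (of_real (ln (cmod z)) + \<i> * of_real \<theta>)) * \<i>)"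

definition I_mu :: "triple list \<Rightarrow> triple list \<Rightarrow> real" where
  "I_mu us ls = (\<Sum>(b, B, \<beta>)\<leftarrow>ls. \<beta> * B) - (\<Sum>(a, A, \<alpha>)\<leftarrow>us. \<alpha> * A)"

definition I_Omega :: "triple list \<Rightarrow> triple list \<Rightarrow> real" where
  "I_Omega us ls =
     (\<Sum>(a, A, \<alpha>)\<leftarrow>us. (1/2 - Re a) * \<alpha>) - (\<Sum>(b, B, \<beta>)\<leftarrow>ls. (1/2 - Re b) * \<beta>)"

definition I_Delta :: "nat \<Rightarrow> nat \<Rightarrow> triple list \<Rightarrow> triple list \<Rightarrow> real" where
  "I_Delta m n us ls =
     (\<Sum>(b, B, \<beta>)\<leftarrow>take m ls. \<beta> * B) - (\<Sum>(b, B, \<beta>)\<leftarrow>drop m ls. \<beta> * B) +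
     (\<Sum>(a, A, \<alpha>)\<leftarrow>take n us. \<alpha> * A) - (\<Sum>(a, A, \<alpha>)\<leftarrow>drop n us. \<alpha> * A)"

definition I_params :: "nat \<Rightarrow> nat \<Rightarrow> triple list \<Rightarrow> triple list \<Rightarrow> bool" where
  "I_params m n us ls \<longleftrightarrow>
     m \<le> length ls \<and> n \<le> length us \<and>
     (\<forall>(a, A, \<alpha>)\<in>set us. A > 0 \<and> \<alpha> > 0) \<and> (\<forall>(b, B, \<beta>)\<in>set ls. B > 0 \<and> \<beta> > 0)"

definition I_separates :: "nat \<Rightarrow> nat \<Rightarrow> triple list \<Rightarrow> triple list \<Rightarrow> bool" where
  "I_separates m n us ls \<longleftrightarrow>
     (\<forall>(b, B, \<beta>)\<in>set (take m ls). \<forall>s::complex. b + of_real B * s \<in> \<int>\<^sub>\<le>\<^sub>0 \<longrightarrow> Re s < 0) \<and>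
     (\<forall>(a, A, \<alpha>)\<in>set (take n us). \<forall>s::complex. 1 - a - of_real A * s \<in> \<int>\<^sub>\<le>\<^sub>0 \<longrightarrow> Re s > 0)"

text \<open>The conditions for absolute convergence, where \<open>\<sigma> = Re s\<close> on the contour.\<close>

definition I_abs_conv ::
  "nat \<Rightarrow> nat \<Rightarrow> triple list \<Rightarrow> triple list \<Rightarrow> real \<Rightarrow> real \<Rightarrow> bool" where
  "I_abs_conv m n us ls \<sigma> \<theta> \<longleftrightarrow>
     (I_Delta m n us ls > 0 \<and> \<bar>\<theta>\<bar> < pi / 2 * I_Delta m n us ls) \<or>
     (I_Delta m n us ls \<ge> 0 \<and> \<bar>\<theta>\<bar> = pi / 2 * I_Delta m n us ls \<and>
       (I_mu us ls = 0 \<and> I_Omega us ls < -1 \<or>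
        I_mu us ls \<noteq> 0 \<and> I_Omega us ls + \<sigma> * I_mu us ls < -1))"

definition I_admissible :: "nat \<Rightarrow> nat \<Rightarrow> triple list \<Rightarrow> triple list \<Rightarrow> real \<Rightarrow> bool" where
  "I_admissible m n us ls \<theta> \<longleftrightarrow>
     I_params m n us ls \<and> I_separates m n us ls \<and> I_abs_conv m n us ls 0 \<theta>"

text \<open>The hypergeometric series; below its argument \<open>1 - x/t\<close> lies in \<open>(0,1)\<close>.\<close>

definition hyp2F1 :: "complex \<Rightarrow> complex \<Rightarrow> complex \<Rightarrow> complex \<Rightarrow> complex" where
  "hyp2F1 a b c z = eval_fps (fps_hypergeo [a, b] [c] 1) z"

definition saigo_integrand ::
  "complex \<Rightarrow> complex \<Rightarrow> complex \<Rightarrow> (real \<Rightarrow> complex) \<Rightarrow> real \<Rightarrow> real \<Rightarrow> complex" where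
  "saigo_integrand \<alpha> \<beta> \<gamma> f x t =
     of_real (t - x) powr (\<alpha> - 1) * of_real t powr (- \<alpha> - \<beta>) *
     hyp2F1 (\<alpha> + \<beta>) (- \<gamma>) \<alpha> (of_real (1 - x / t)) * f t"

definition saigo_integral ::
  "complex \<Rightarrow> complex \<Rightarrow> complex \<Rightarrow> (real \<Rightarrow> complex) \<Rightarrow> real \<Rightarrow> complex" where
  "saigo_integral \<alpha> \<beta> \<gamma> f x =
     1 / Gamma \<alpha> * (LINT t:{x<..}|lborel. saigo_integrand \<alpha> \<beta> \<gamma> f x t)"

definition neg_deriv :: "(real \<Rightarrow> complex) \<Rightarrow> real \<Rightarrow> complex" where
  "neg_deriv g = (\<lambda>x. - vector_derivative g (at x))"

definition saigo_deriv ::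
  "complex \<Rightarrow> complex \<Rightarrow> complex \<Rightarrow> (real \<Rightarrow> complex) \<Rightarrow> real \<Rightarrow> complex" where
  "saigo_deriv \<alpha> \<beta> \<gamma> f x =
     (let N = nat \<lfloor>Re \<alpha>\<rfloor> + 1 in
      (neg_deriv ^^ N) (saigo_integral (- \<alpha> + of_nat N) (- \<beta> - of_nat N) (\<alpha> + \<gamma>) f) x)"

text \<open>
  Integrals and derivatives are total functions in the library.  The following predicate says that
  the fractional derivative is well defined on the positive axis: the integral converges absolutely
  and all the derivatives taken exist.
\<close>

definition saigo_deriv_defined ::
  "complex \<Rightarrow> complex \<Rightarrow> complex \<Rightarrow> (real \<Rightarrow> complex) \<Rightarrow> bool" where
  "saigo_deriv_defined \<alpha> \<beta> \<gamma> f \<longleftrightarrow>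
     (let N = nat \<lfloor>Re \<alpha>\<rfloor> + 1; \<alpha>' = - \<alpha> + of_nat N; \<beta>' = - \<beta> - of_nat N; \<gamma>' = \<alpha> + \<gamma> in
      \<forall>x>0. set_integrable lborel {x<..} (saigo_integrand \<alpha>' \<beta>' \<gamma>' f x) \<and>
        (\<forall>k<N. (neg_deriv ^^ k) (saigo_integral \<alpha>' \<beta>' \<gamma>' f) differentiable (at x)))"

end

theory Submission
  imports Defs "HOL-Real_Asymp.Real_Asymp" "HOL-Complex_Analysis.Cauchy_Integral_Theorem"
begin

text \<open>
On powers the operator is explicit.  With \<open>\<alpha>'\<close>, \<open>\<beta>'\<close>, \<open>\<gamma>'\<close> the
parameters of a right-sided Saigo integral, that integral maps \<open>t\<^sup>-\<^sup>\<sigma>\<close> to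
\[ \frac{\Gamma(\beta' + \sigma) \Gamma(\gamma' + \sigma)}{\Gamma(\sigma) \Gamma(\alpha' + \beta' + \gamma' + \sigma)}\, x^{-\beta'-\sigma}, \]
and \<open>N\<close> negated derivatives replace \<open>\<Gamma>(\<beta>' + \<sigma>)\<close> by
\<open>\<Gamma>(\<beta>' + \<sigma> + N)\<close>.  For \<open>\<alpha>' = N - \<alpha>\<close>,
\<open>\<beta>' = -\<beta> - N\<close>, \<open>\<gamma>' = \<alpha> + \<gamma>\<close> this leaves four Gamma functions.

By its definition as an integral over the contour \<open>s = iy\<close>, the function
\<open>t\<^sup>-\<^sup>\<rho> I[a t\<^sup>-\<^sup>\<mu>]\<close> is a superposition of the powers
\<open>t\<^sup>-\<^sup>\<sigma>\<close> with \<open>\<sigma> = \<rho> - \<mu>s\<close>.  The operator may be applied under the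
integral sign, and the four Gamma functions at \<open>\<sigma> = \<rho> - \<mu>s\<close> are the factors of the
four new parameter triples, two in the numerator and two in the denominator.  The condition on
\<open>\<rho>\<close> says that \<open>\<beta>' + \<sigma>\<close> and \<open>\<gamma>' + \<sigma>\<close> have positive real part on
the contour, which is what the evaluation on powers requires.

Three analytic points carry the argument.  First, the conditions on \<open>\<Delta>\<close>,
\<open>\<Omega>\<close> and \<open>\<theta>\<close> must give absolute convergence of the contour integrals; this
needs the size of \<open>\<Gamma>\<close> on vertical lines (\<open>ln_norm_Gamma_line_approx\<close>,
\<open>line_growth_I_chi\<close>, \<open>integrable_line_growth\<close>).  Secondly, the action on powers is
the Mellin transform of the hypergeometric kernel (\<open>hypergeometric_kernel_mellin\<close>); it follows
by termwise integration from the beta integral and Gauss's value of \<open>\<^sub>2F\<^sub>1\<close> at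
\<open>1\<close> (\<open>gauss_hypergeometric_sum\<close>).  Thirdly, the interchanges: since all exponents on the
contour share one real part, the modulus of the double integrand is a product, so Fubini's theorem
applies (\<open>saigo_integral_power_mixture\<close>), and the derivatives are taken by dominated convergence
(\<open>neg_deriv_funpow_power_mixture\<close>), with convergence after the last one supplied by the
admissibility of the new parameters.
\<close>

section \<open>Stirling bounds on vertical lines\<close>

text \<open>
Every increment \<open>ln |z + n + 1| - ln |z + n|\<close> is the real part of
\<open>Ln (1 + 1/(z + n))\<close>, hence \<open>Re (1/(z + n))\<close> up to an error of order
\<open>1/(n + 1)\<^sup>2\<close>.  Summing these and letting the number of terms grow turns the limit
formula for the digamma function into \<open>Re \<psi>(z) = ln |z| + O(1)\<close>.  A bounded error is
all that is needed, and it is uniform in the half-plane.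
\<close>

lemma Re_Digamma_approx:
  obtains K where "\<And>z::complex. \<lbrakk>Re z \<ge> 1; norm z \<ge> 2\<rbrakk> \<Longrightarrow> \<bar>Re (Digamma z) - ln (norm z)\<bar> \<le> K"
proof -
  define S where "S = (\<Sum>n. 2 / (real n + 1)\<^sup>2)"
  have summ: "summable (\<lambda>n. 2 / (real n + 1)\<^sup>2)"
  proof -
    have "summable (\<lambda>n. inverse (real n ^ 2))"
      using inverse_power_summable[of 2, where 'a = real] by simp
    hence "summable (\<lambda>n. inverse (real (Suc n) ^ 2))"
      by (subst summable_Suc_iff)
    from summable_mult[OF this, of 2] show ?thesis
      by (simp add: field_simps)
  qed
  have "\<bar>Re (Digamma z) - ln (norm z)\<bar> \<le> S" if z: "Re z \<ge> 1" "norm z \<ge> 2" for z :: complex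
  proof -
    have nz: "z + of_nat n \<noteq> 0" for n
      using z(1) by (auto simp: complex_eq_iff)
    have n1: "norm (z + of_nat n) \<ge> real n + 1" for n
      using z(1) complex_Re_le_cmod[of "z + of_nat n"] by simp
    have n2: "norm (z + of_nat n) \<ge> 2" for n
    proof -
      have "\<bar>Re z\<bar> \<le> \<bar>Re z + real n\<bar>" using z by simp
      hence "(Re z)\<^sup>2 \<le> (Re z + real n)\<^sup>2" by (rule abs_le_square_iff[THEN iffD1])
      hence "norm z \<le> norm (z + of_nat n)"
        by (simp add: cmod_def)
      with z show ?thesis by simp
    qed
    have step: "\<bar>ln (norm (z + of_nat (Suc n))) - ln (norm (z + of_nat n)) - Re (inverse (z + of_nat n))\<bar>
        \<le> 2 / (real n + 1)\<^sup>2" for n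
    proof -
      define w where "w = inverse (z + of_nat n)"
      have w: "norm w \<le> 1/2" using le_imp_inverse_le[OF n2[of n]] by (simp add: w_def norm_inverse)
      have w': "norm w \<le> 1 / (real n + 1)" using le_imp_inverse_le[OF n1[of n]]
        by (simp add: w_def norm_inverse inverse_eq_divide norm_divide)
      have "z + of_nat (Suc n) = (z + of_nat n) * (1 + w)"
        using nz[of n] by (simp add: w_def field_simps)
      moreover have "1 + w \<noteq> 0"
      proof
        assume "1 + w = 0"
        hence "w = -1" by (simp add: add_eq_0_iff)
        with w show False by simp
      qed
      ultimately have "ln (norm (z + of_nat (Suc n))) = ln (norm (z + of_nat n)) + ln (norm (1 + w))"
        using nz[of n] by (simp add: norm_mult ln_mult)
      moreover have "ln (norm (1 + w)) = Re (Ln (1 + w))" using \<open>1 + w \<noteq> 0\<close> by simp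
      ultimately have "\<bar>ln (norm (z + of_nat (Suc n))) - ln (norm (z + of_nat n)) - Re w\<bar> = \<bar>Re (Ln (1 + w) - w)\<bar>"
        by simp
      also have "\<dots> \<le> norm (Ln (1 + w) - w)" by (rule abs_Re_le_cmod)
      also have "\<dots> \<le> (norm w)\<^sup>2 / (1 - norm w)" by (rule Ln_approx_linear) (use w in simp)
      also have "\<dots> \<le> (norm w)\<^sup>2 / (1/2)" using w by (intro divide_left_mono) auto
      also have "\<dots> = 2 * (norm w)\<^sup>2" by simp
      also have "\<dots> \<le> 2 * (1 / (real n + 1))\<^sup>2" using w' by (intro mult_left_mono power_mono) auto
      finally show ?thesis by (simp add: w_def power_divide)
    qed
    have sum_bound: "\<bar>ln (norm (z + of_nat m)) - ln (norm z) - (\<Sum>n<m. Re (inverse (z + of_nat n)))\<bar> \<le> S" for m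
    proof -
      have "ln (norm (z + of_nat m)) - ln (norm z) - (\<Sum>n<m. Re (inverse (z + of_nat n))) =
        (\<Sum>n<m. ln (norm (z + of_nat (Suc n))) - ln (norm (z + of_nat n)) - Re (inverse (z + of_nat n)))"
        using sum_lessThan_telescope[of "\<lambda>n. ln (norm (z + of_nat n))" m]
        by (simp add: sum_subtractf)
      also have "\<bar>\<dots>\<bar> \<le> (\<Sum>n<m. 2 / (real n + 1)\<^sup>2)"
        by (rule order_trans[OF sum_abs sum_mono]) (rule step)
      also have "\<dots> \<le> S" unfolding S_def by (rule sum_le_suminf[OF summ]) auto
      finally show ?thesis .
    qed
    have lim1: "(\<lambda>m. ln (real m) - ln (norm (z + of_nat m))) \<longlonglongrightarrow> 0"
    proof -
      have "(\<lambda>m. z / of_nat m + 1) \<longlonglongrightarrow> 0 + 1"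
        by (intro tendsto_intros tendsto_divide_0[OF tendsto_const] tendsto_of_nat)
      hence "(\<lambda>m. - ln (norm (z / of_nat m + 1))) \<longlonglongrightarrow> - ln (norm (0 + 1 :: complex))"
        by (intro tendsto_intros) auto
      hence "(\<lambda>m. - ln (norm (z / of_nat m + 1))) \<longlonglongrightarrow> 0" by simp
      moreover have "eventually (\<lambda>m. - ln (norm (z / of_nat m + 1)) = ln (real m) - ln (norm (z + of_nat m))) sequentially"
        using eventually_gt_at_top[of 0]
      proof eventually_elim
        case (elim m)
        have "z / of_nat m + 1 = (z + of_nat m) / of_nat m" using elim by (simp add: field_simps)
        thus ?case using elim nz[of m] by (simp add: norm_divide ln_div)
      qed
      ultimately show ?thesis by (rule Lim_transform_eventually)
    qed
    have "(\<lambda>m. Re (of_real (ln (real m)) - (\<Sum>n<m. inverse (z + of_nat n)))) \<longlonglongrightarrow> Re (Digamma z)"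
      by (intro tendsto_Re Digamma_LIMSEQ) (use nz[of 0] in simp)
    from tendsto_diff[OF tendsto_diff[OF this lim1] tendsto_const[of "ln (norm z)"]]
    have "(\<lambda>m. ln (norm (z + of_nat m)) - ln (norm z) - (\<Sum>n<m. Re (inverse (z + of_nat n))))
       \<longlonglongrightarrow> Re (Digamma z) - ln (norm z)" by (simp add: algebra_simps)
    from tendsto_rabs[OF this] show ?thesis
      by (rule tendsto_upperbound) (use sum_bound in auto)
  qed
  thus ?thesis by (rule that)
qed

text \<open>
Reflection gives the modulus on the imaginary axis exactly, because
\<open>\<Gamma>(-iy)\<close> is the conjugate of \<open>\<Gamma>(iy)\<close>.
\<close>

lemma norm_Gamma_imaginary:
  assumes "y \<noteq> 0"
  shows "(norm (Gamma (\<i> * of_real y)))\<^sup>2 = pi / (\<bar>y\<bar> * sinh (pi * \<bar>y\<bar>))"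
proof -
  have "Gamma (- (\<i> * of_real y)) = cnj (Gamma (\<i> * of_real y))"
    by (simp add: cnj_Gamma)
  hence "(norm (Gamma (\<i> * of_real y)))\<^sup>2 = norm (Gamma (\<i> * of_real y) * Gamma (- (\<i> * of_real y)))"
    by (simp add: norm_mult power2_eq_square)
  also have "\<dots> = norm (of_real pi / (\<i> * of_real y * sin (of_real pi * (\<i> * of_real y)) :: complex))"
    by (subst Gamma_reflection_complex') simp
  also have "sin (of_real pi * (\<i> * of_real y) :: complex) = \<i> * of_real (sinh (pi * y))"
    by (simp add: sinh_def sin_exp_eq exp_of_real[symmetric] exp_minus scaleR_conv_of_real field_simps)
  finally show ?thesis
    using assms by (simp add: norm_divide norm_mult sinh_real_abs[symmetric] abs_mult)
qed

lemma ln_sinh_approx: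
  fixes t :: real
  assumes "t \<ge> 1"
  shows "\<bar>ln (sinh t) - t\<bar> \<le> ln 4"
proof -
  have "exp t \<ge> 2"
    using exp_ge_add_one_self[of t] assms by linarith
  moreover have "exp (- t) \<le> 1" using assms by simp
  ultimately have "exp (- t) \<le> exp t / 2" by linarith
  hence "exp t / 4 \<le> sinh t" by (simp add: sinh_def field_simps)
  moreover have "sinh t = (exp t - exp (- t)) / 2" by (simp add: sinh_def)
  moreover have "exp (- t) > 0" by simp
  ultimately have "exp t / 4 \<le> sinh t \<and> sinh t \<le> exp t" by argo
  hence "ln (exp t / 4) \<le> ln (sinh t)" "ln (sinh t) \<le> ln (exp t)"
    using assms by (intro ln_mono; simp add: sinh_real_pos_iff)+
  hence "ln (sinh t) \<le> t" "t - ln 4 \<le> ln (sinh t)" unfolding ln_exp by (simp_all add: ln_div)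
  thus ?thesis unfolding abs_le_iff using ln_ge_zero[of 4] by linarith
qed

lemma norm_Gamma_line_approx_1:
  assumes "\<bar>y\<bar> \<ge> 1"
  shows "\<bar>ln (norm (Gamma (1 + \<i> * of_real y))) - (1/2 * ln \<bar>y\<bar> - pi / 2 * \<bar>y\<bar>)\<bar> \<le> ln pi + ln 4"
proof -
  define t where "t = pi * \<bar>y\<bar>"
  have "1 * 1 \<le> pi * \<bar>y\<bar>" using assms pi_ge_two by (intro mult_mono) auto
  hence t: "t \<ge> 1" by (simp add: t_def)
  have y: "y \<noteq> 0" using assms by auto
  have "\<i> * of_real y \<notin> \<int>\<^sub>\<le>\<^sub>0" using y by (auto elim!: nonpos_Ints_cases simp: complex_eq_iff)
  hence "Gamma (1 + \<i> * of_real y) = \<i> * of_real y * Gamma (\<i> * of_real y)"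
    using Gamma_plus1[of "\<i> * of_real y"] by (metis add.commute zero_in_nonpos_Ints)
  hence "(norm (Gamma (1 + \<i> * of_real y)))\<^sup>2 = \<bar>y\<bar>\<^sup>2 * (norm (Gamma (\<i> * of_real y)))\<^sup>2"
    by (simp add: norm_mult power_mult_distrib)
  also have "\<dots> = \<bar>y\<bar> * (pi / sinh t)"
    by (subst norm_Gamma_imaginary[OF y]) (auto simp: t_def power2_eq_square abs_if)
  finally have "ln ((norm (Gamma (1 + \<i> * of_real y)))\<^sup>2) = ln (\<bar>y\<bar> * (pi / sinh t))" by simp
  also have "\<dots> = ln \<bar>y\<bar> + ln pi - ln (sinh t)"
    using y t by (simp add: ln_mult ln_div sinh_real_pos_iff)
  finally have "2 * ln (norm (Gamma (1 + \<i> * of_real y))) = ln \<bar>y\<bar> + ln pi - ln (sinh t)"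
    by (simp add: ln_realpow)
  moreover have "ln pi \<ge> 0" using pi_ge_two by (intro ln_ge_zero) linarith
  moreover have "ln 4 \<ge> (0::real)" by simp
  moreover have "pi / 2 * \<bar>y\<bar> = t / 2" by (simp add: t_def)
  ultimately show ?thesis using ln_sinh_approx[OF t]
    unfolding abs_le_iff by linarith
qed

lemma ln_norm_Complex_approx:
  assumes "\<bar>y\<bar> \<ge> 1"
  shows "\<bar>ln (norm (Complex x y)) - ln \<bar>y\<bar>\<bar> \<le> ln (1 + \<bar>x\<bar>)"
proof -
  have 1: "\<bar>y\<bar> \<le> norm (Complex x y)" using abs_Im_le_cmod[of "Complex x y"] by simp
  have "norm (Complex x y) \<le> \<bar>x\<bar> + \<bar>y\<bar>" using cmod_le[of "Complex x y"] by simp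
  also have "\<dots> \<le> (1 + \<bar>x\<bar>) * \<bar>y\<bar>" using mult_left_mono[OF assms, of "\<bar>x\<bar>"] by (simp add: algebra_simps)
  finally have "ln (norm (Complex x y)) \<le> ln ((1 + \<bar>x\<bar>) * \<bar>y\<bar>)" using 1 assms by (intro ln_mono) auto
  also have "\<dots> = ln (1 + \<bar>x\<bar>) + ln \<bar>y\<bar>" using assms by (subst ln_mult) auto
  finally have "ln (norm (Complex x y)) - ln \<bar>y\<bar> \<le> ln (1 + \<bar>x\<bar>)" by simp
  moreover have "ln \<bar>y\<bar> \<le> ln (norm (Complex x y))" using 1 assms by (intro ln_mono) auto
  moreover have "0 \<le> ln (1 + \<bar>x\<bar>)" by simp
  ultimately show ?thesis by (simp add: abs_le_iff)
qed

text \<open>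
The two-sided form of Stirling's formula on a vertical line,
\<open>|\<Gamma>(x + iy)|\<close> comparable to \<open>|y|\<^sup>x\<^sup>-\<^sup>1\<^sup>/\<^sup>2 exp (-\<pi>|y|/2)\<close>.
On the line \<open>x = 1\<close> it comes from reflection.  The derivative of
\<open>ln |\<Gamma>(x + iy)|\<close> in \<open>x\<close> is \<open>Re \<psi>(x + iy) = ln |y| + O(1)\<close>, so the
mean value theorem carries it to every \<open>x \<ge> 1\<close>, and the functional equation to the
lines further left.
\<close>

lemma ln_norm_Gamma_line_approx:
  obtains K where "\<And>y. \<bar>y\<bar> \<ge> 2 \<Longrightarrow>
    \<bar>ln (norm (Gamma (Complex x y))) - ((x - 1/2) * ln \<bar>y\<bar> - pi / 2 * \<bar>y\<bar>)\<bar> \<le> K"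
proof -
  define P where "P = (\<lambda>x K. \<forall>y. \<bar>y\<bar> \<ge> 2 \<longrightarrow>
    \<bar>ln (norm (Gamma (Complex x y))) - ((x - 1/2) * ln \<bar>y\<bar> - pi / 2 * \<bar>y\<bar>)\<bar> \<le> K)"
  obtain D where D: "\<And>z::complex. \<lbrakk>Re z \<ge> 1; norm z \<ge> 2\<rbrakk> \<Longrightarrow> \<bar>Re (Digamma z) - ln (norm z)\<bar> \<le> D"
    using Re_Digamma_approx by blast
  have ge1: "P x ((D + ln (1 + x)) * (x - 1) + (ln pi + ln 4))" if x: "x \<ge> 1" for x
    unfolding P_def
  proof (intro allI impI)
    fix y :: real assume y: "\<bar>y\<bar> \<ge> 2"
    define F where "F = (\<lambda>u. Re (ln_Gamma (of_real u + \<i> * of_real y)) - u * ln \<bar>y\<bar>)"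
    have nr: "of_real u + \<i> * of_real y \<notin> \<real>\<^sub>\<le>\<^sub>0" for u
      using y by (auto simp: complex_nonpos_Reals_iff)
    have der: "(F has_real_derivative (Re (Digamma (of_real u + \<i> * of_real y)) - ln \<bar>y\<bar>)) (at u)" for u
    proof -
      have "((\<lambda>u. ln_Gamma (of_real u + \<i> * of_real y)) has_vector_derivative Digamma (of_real u + \<i> * of_real y)) (at u)"
        using nr by (auto intro!: has_vector_derivative_real_field derivative_eq_intros)
      from bounded_linear.has_vector_derivative[OF bounded_linear_Re this]
      have "((\<lambda>u. Re (ln_Gamma (of_real u + \<i> * of_real y))) has_real_derivative Re (Digamma (of_real u + \<i> * of_real y))) (at u)"
        by (simp add: has_real_derivative_iff_has_vector_derivative)
      moreover have "((\<lambda>u. u * ln \<bar>y\<bar>) has_real_derivative ln \<bar>y\<bar>) (at u)"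
        by (auto intro!: derivative_eq_intros)
      ultimately show ?thesis unfolding F_def by (rule DERIV_diff)
    qed
    have bnd: "\<bar>Re (Digamma (of_real u + \<i> * of_real y)) - ln \<bar>y\<bar>\<bar> \<le> D + ln (1 + x)" if u: "1 \<le> u" "u \<le> x" for u
    proof -
      have e: "of_real u + \<i> * of_real y = Complex u y" by (simp add: complex_eq_iff)
      have "norm (Complex u y) \<ge> 2" using abs_Im_le_cmod[of "Complex u y"] y by simp
      with D[of "Complex u y"] u have "\<bar>Re (Digamma (Complex u y)) - ln (norm (Complex u y))\<bar> \<le> D" by simp
      moreover have "\<bar>ln (norm (Complex u y)) - ln \<bar>y\<bar>\<bar> \<le> ln (1 + \<bar>u\<bar>)"
        using y by (intro ln_norm_Complex_approx) auto
      moreover have "ln (1 + \<bar>u\<bar>) \<le> ln (1 + x)" using u by (intro ln_mono) auto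
      ultimately show ?thesis unfolding e by linarith
    qed
    have "norm (F x - F 1) \<le> (D + ln (1 + x)) * norm (x - 1)"
    proof (rule field_differentiable_bound[of "{1..x}"])
      show "(F has_field_derivative (Re (Digamma (of_real u + \<i> * of_real y)) - ln \<bar>y\<bar>)) (at u within {1..x})" for u
        by (rule has_field_derivative_at_within[OF der])
    qed (use bnd x in auto)
    hence *: "\<bar>F x - F 1\<bar> \<le> (D + ln (1 + x)) * (x - 1)" using x by simp
    have F: "F u = ln (norm (Gamma (Complex u y))) - u * ln \<bar>y\<bar>" for u
    proof -
      have "of_real u + \<i> * of_real y \<notin> \<int>\<^sub>\<le>\<^sub>0" using y by (auto elim!: nonpos_Ints_cases simp: complex_eq_iff)
      hence "norm (Gamma (of_real u + \<i> * of_real y)) = exp (Re (ln_Gamma (of_real u + \<i> * of_real y)))"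
        by (simp add: Gamma_complex_altdef norm_exp_eq_Re)
      moreover have "of_real u + \<i> * of_real y = Complex u y" by (simp add: complex_eq_iff)
      ultimately show ?thesis by (simp add: F_def)
    qed
    have "1 + \<i> * of_real y = Complex 1 y" by (simp add: complex_eq_iff)
    with norm_Gamma_line_approx_1[of y] y
    have "\<bar>ln (norm (Gamma (Complex 1 y))) - (1/2 * ln \<bar>y\<bar> - pi / 2 * \<bar>y\<bar>)\<bar> \<le> ln pi + ln 4" by simp
    with * show "\<bar>ln (norm (Gamma (Complex x y))) - ((x - 1/2) * ln \<bar>y\<bar> - pi / 2 * \<bar>y\<bar>)\<bar>
      \<le> (D + ln (1 + x)) * (x - 1) + (ln pi + ln 4)"
      unfolding F abs_le_iff left_diff_distrib by linarith
  qed
  have down: "P x (K + ln (1 + \<bar>x\<bar>))" if "P (x + 1) K" for x K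
    unfolding P_def
  proof (intro allI impI)
    fix y :: real assume y: "\<bar>y\<bar> \<ge> 2"
    have ni: "Complex x y \<notin> \<int>\<^sub>\<le>\<^sub>0" using y by (auto elim!: nonpos_Ints_cases simp: complex_eq_iff)
    have "Complex (x + 1) y = Complex x y + 1" by (simp add: complex_eq_iff)
    hence "Gamma (Complex (x + 1) y) = Complex x y * Gamma (Complex x y)"
      using Gamma_plus1[of "Complex x y"] ni by (metis zero_in_nonpos_Ints)
    moreover have "Complex x y \<noteq> 0" "Gamma (Complex x y) \<noteq> 0" using ni by (auto simp: Gamma_eq_zero_iff)
    ultimately have "ln (norm (Gamma (Complex (x + 1) y))) = ln (norm (Complex x y)) + ln (norm (Gamma (Complex x y)))"
      by (simp add: norm_mult ln_mult)
    moreover have "\<bar>ln (norm (Complex x y)) - ln \<bar>y\<bar>\<bar> \<le> ln (1 + \<bar>x\<bar>)"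
      using y by (intro ln_norm_Complex_approx) auto
    moreover have "\<bar>ln (norm (Gamma (Complex (x + 1) y))) - ((x + 1 - 1/2) * ln \<bar>y\<bar> - pi / 2 * \<bar>y\<bar>)\<bar> \<le> K"
      using that y unfolding P_def by blast
    ultimately show "\<bar>ln (norm (Gamma (Complex x y))) - ((x - 1/2) * ln \<bar>y\<bar> - pi / 2 * \<bar>y\<bar>)\<bar> \<le> K + ln (1 + \<bar>x\<bar>)"
      by (simp add: abs_le_iff algebra_simps)
  qed
  have "\<exists>K. P x K" if "x + real n \<ge> 1" for x n
    using that
  proof (induction n arbitrary: x)
    case 0
    thus ?case using ge1 by auto
  next
    case (Suc n)
    have "\<exists>K. P (x + 1) K" by (rule Suc.IH) (use Suc.prems in simp)
    thus ?case using down by blast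
  qed
  moreover obtain n where "x + real n \<ge> 1"
    using real_arch_simple[of "1 - x"] by (metis add.commute diff_le_eq)
  ultimately show ?thesis using that unfolding P_def by blast
qed

section \<open>Growth of the integrand and absolute convergence\<close>

text \<open>
A factor \<open>\<Gamma>\<^sup>\<kappa>(c + ids)\<close> is of size \<open>|y|\<^sup>e exp (-\<pi>\<delta>|y|/2)\<close>
for large \<open>|y|\<close>.  Recording the pair \<open>(e, \<delta>)\<close> makes products of such factors a
matter of adding pairs.  The bound with \<open>1 + |y|\<close> holds on the whole line, so that it
also covers the behaviour near the origin.
\<close>

definition line_growth :: "real \<Rightarrow> real \<Rightarrow> (real \<Rightarrow> complex) \<Rightarrow> bool" where
  "line_growth e \<delta> g \<longleftrightarrow> g \<in> borel_measurable borel \<and>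
     (\<exists>K. \<forall>y. norm (g y) \<le> K * ((1 + \<bar>y\<bar>) powr e * exp (- (pi / 2 * \<delta> * \<bar>y\<bar>))))"

lemma line_growth_const_1: "line_growth 0 0 (\<lambda>y. 1)"
  unfolding line_growth_def by (auto intro!: exI[of _ 1])

lemma line_growth_mult:
  assumes "line_growth e \<delta> g" "line_growth e' \<delta>' h"
  shows "line_growth (e + e') (\<delta> + \<delta>') (\<lambda>y. g y * h y)"
proof -
  from assms obtain K K' where
    K: "\<And>y. norm (g y) \<le> K * ((1 + \<bar>y\<bar>) powr e * exp (- (pi / 2 * \<delta> * \<bar>y\<bar>)))" and
    K': "\<And>y. norm (h y) \<le> K' * ((1 + \<bar>y\<bar>) powr e' * exp (- (pi / 2 * \<delta>' * \<bar>y\<bar>)))" and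
    [measurable]: "g \<in> borel_measurable borel" "h \<in> borel_measurable borel"
    unfolding line_growth_def by blast
  have "norm (g y * h y) \<le> (K * K') * ((1 + \<bar>y\<bar>) powr (e + e') * exp (- (pi / 2 * (\<delta> + \<delta>') * \<bar>y\<bar>)))" for y
  proof -
    have "norm (g y * h y) \<le> (K * ((1 + \<bar>y\<bar>) powr e * exp (- (pi / 2 * \<delta> * \<bar>y\<bar>)))) *
        (K' * ((1 + \<bar>y\<bar>) powr e' * exp (- (pi / 2 * \<delta>' * \<bar>y\<bar>))))"
      unfolding norm_mult by (intro mult_mono K K' norm_ge_zero order_trans[OF norm_ge_zero K])
    also have "\<dots> = (K * K') * ((1 + \<bar>y\<bar>) powr (e + e') *
        (exp (- (pi / 2 * \<delta> * \<bar>y\<bar>)) * exp (- (pi / 2 * \<delta>' * \<bar>y\<bar>))))"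
      by (simp add: powr_add mult_ac)
    also have "exp (- (pi / 2 * \<delta> * \<bar>y\<bar>)) * exp (- (pi / 2 * \<delta>' * \<bar>y\<bar>)) = exp (- (pi / 2 * (\<delta> + \<delta>') * \<bar>y\<bar>))"
      unfolding exp_add[symmetric] by (simp add: algebra_simps)
    finally show ?thesis .
  qed
  moreover have "(\<lambda>y. g y * h y) \<in> borel_measurable borel" by measurable
  ultimately show ?thesis unfolding line_growth_def by blast
qed

lemma line_growth_prod_list:
  assumes "\<And>x. x \<in> set xs \<Longrightarrow> line_growth (e x) (\<delta> x) (g x)"
  shows "line_growth (\<Sum>x\<leftarrow>xs. e x) (\<Sum>x\<leftarrow>xs. \<delta> x) (\<lambda>y. \<Prod>x\<leftarrow>xs. g x y)"
  using assms
proof (induction xs)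
  case (Cons x xs)
  have "line_growth (e x) (\<delta> x) (g x)"
    "line_growth (\<Sum>x\<leftarrow>xs. e x) (\<Sum>x\<leftarrow>xs. \<delta> x) (\<lambda>y. \<Prod>x\<leftarrow>xs. g x y)"
    using Cons by auto
  from line_growth_mult[OF this] show ?case by simp
qed (use line_growth_const_1 in simp)

text \<open>
The argument \<open>c + idy\<close> has height \<open>Im c + dy\<close>, which for large \<open>|y|\<close> differs
from \<open>dy\<close> by a bounded amount; both \<open>ln\<close> of it and the exponent change by
\<open>O(1)\<close> only.
\<close>

lemma ln_norm_Gamma_line_approx_affine:
  assumes "d \<noteq> 0"
  obtains K Y where "\<And>y. \<bar>y\<bar> \<ge> Y \<Longrightarrow> c + of_real d * (\<i> * of_real y) \<notin> \<int>\<^sub>\<le>\<^sub>0 \<and>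
    \<bar>ln (norm (Gamma (c + of_real d * (\<i> * of_real y)))) -
      ((Re c - 1/2) * ln (1 + \<bar>y\<bar>) - pi / 2 * \<bar>d\<bar> * \<bar>y\<bar>)\<bar> \<le> K"
proof -
  obtain K where K: "\<And>y. \<bar>y\<bar> \<ge> 2 \<Longrightarrow>
    \<bar>ln (norm (Gamma (Complex (Re c) y))) - ((Re c - 1/2) * ln \<bar>y\<bar> - pi / 2 * \<bar>y\<bar>)\<bar> \<le> K"
    using ln_norm_Gamma_line_approx[of "Re c"] by blast
  define B where "B = \<bar>Im c\<bar>"
  define M where "M = \<bar>ln (\<bar>d\<bar> / 4)\<bar> + \<bar>ln (B + \<bar>d\<bar>)\<bar>"
  define Y where "Y = (2 * B + 4) / \<bar>d\<bar> + 1"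
  show ?thesis
  proof (rule that)
    fix y :: real assume y: "\<bar>y\<bar> \<ge> Y"
    define v where "v = Im c + d * y"
    have d: "\<bar>d\<bar> > 0" and B: "B \<ge> 0" using assms by (auto simp: B_def)
    have "(2 * B + 4) / \<bar>d\<bar> \<ge> 0" using d B by simp
    hence y1: "\<bar>y\<bar> \<ge> 1" using y unfolding Y_def by linarith
    have "(2 * B + 4) / \<bar>d\<bar> \<le> \<bar>y\<bar>" using y by (simp add: Y_def)
    hence dy: "2 * B + 4 \<le> \<bar>d\<bar> * \<bar>y\<bar>" using d by (simp add: divide_le_eq mult.commute)
    have absdy: "\<bar>d * y\<bar> = \<bar>d\<bar> * \<bar>y\<bar>" by (rule abs_mult)
    have v_lo: "\<bar>v\<bar> \<ge> \<bar>d\<bar> * \<bar>y\<bar> - B" and v_hi: "\<bar>v\<bar> \<le> \<bar>d\<bar> * \<bar>y\<bar> + B"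
      using absdy unfolding v_def B_def by linarith+
    have v2: "\<bar>v\<bar> \<ge> 2" using v_lo dy B by linarith
    have "\<bar>d\<bar> * 1 \<le> \<bar>d\<bar> * \<bar>y\<bar>" using y1 by (intro mult_left_mono) auto
    hence "\<bar>d\<bar> / 4 * (1 + \<bar>y\<bar>) \<le> \<bar>v\<bar>" using v_lo dy B by (simp add: distrib_left)
    hence "ln (\<bar>d\<bar> / 4 * (1 + \<bar>y\<bar>)) \<le> ln \<bar>v\<bar>" using d by (intro ln_mono) auto
    moreover have "ln (\<bar>d\<bar> / 4 * (1 + \<bar>y\<bar>)) = ln (\<bar>d\<bar> / 4) + ln (1 + \<bar>y\<bar>)" using d by (subst ln_mult) auto
    ultimately have l1: "ln (\<bar>d\<bar> / 4) + ln (1 + \<bar>y\<bar>) \<le> ln \<bar>v\<bar>" by simp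
    have "B * 1 \<le> B * (1 + \<bar>y\<bar>)" using B by (intro mult_left_mono) auto
    hence "\<bar>v\<bar> \<le> (B + \<bar>d\<bar>) * (1 + \<bar>y\<bar>)" using v_hi by (simp add: algebra_simps)
    hence "ln \<bar>v\<bar> \<le> ln ((B + \<bar>d\<bar>) * (1 + \<bar>y\<bar>))" using v2 by (intro ln_mono) auto
    also have "\<dots> = ln (B + \<bar>d\<bar>) + ln (1 + \<bar>y\<bar>)" using d B by (subst ln_mult) auto
    finally have l2: "ln \<bar>v\<bar> \<le> ln (B + \<bar>d\<bar>) + ln (1 + \<bar>y\<bar>)" .
    have lnv: "\<bar>ln \<bar>v\<bar> - ln (1 + \<bar>y\<bar>)\<bar> \<le> M" using l1 l2 unfolding M_def by linarith
    have "\<bar>(Re c - 1/2) * (ln \<bar>v\<bar> - ln (1 + \<bar>y\<bar>))\<bar> \<le> \<bar>Re c - 1/2\<bar> * M"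
      unfolding abs_mult using lnv by (intro mult_left_mono) auto
    hence A1: "\<bar>(Re c - 1/2) * ln \<bar>v\<bar> - (Re c - 1/2) * ln (1 + \<bar>y\<bar>)\<bar> \<le> \<bar>Re c - 1/2\<bar> * M"
      by (simp add: right_diff_distrib)
    have "\<bar>pi / 2 * (\<bar>v\<bar> - \<bar>d\<bar> * \<bar>y\<bar>)\<bar> \<le> pi / 2 * B"
      unfolding abs_mult using v_lo v_hi by (intro mult_mono) (auto simp: abs_diff_le_iff)
    hence A2: "\<bar>pi / 2 * \<bar>v\<bar> - pi / 2 * \<bar>d\<bar> * \<bar>y\<bar>\<bar> \<le> pi / 2 * B"
      by (simp add: right_diff_distrib mult.assoc)
    have e: "c + of_real d * (\<i> * of_real y) = Complex (Re c) v" by (simp add: complex_eq_iff v_def)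
    have "Complex (Re c) v \<notin> \<int>\<^sub>\<le>\<^sub>0" using v2 by (auto elim!: nonpos_Ints_cases simp: complex_eq_iff)
    moreover have "\<bar>ln (norm (Gamma (Complex (Re c) v))) -
      ((Re c - 1/2) * ln (1 + \<bar>y\<bar>) - pi / 2 * \<bar>d\<bar> * \<bar>y\<bar>)\<bar> \<le> K + \<bar>Re c - 1/2\<bar> * M + pi / 2 * B"
      using K[OF v2] A1 A2 unfolding abs_le_iff by linarith
    ultimately show "c + of_real d * (\<i> * of_real y) \<notin> \<int>\<^sub>\<le>\<^sub>0 \<and>
      \<bar>ln (norm (Gamma (c + of_real d * (\<i> * of_real y)))) -
      ((Re c - 1/2) * ln (1 + \<bar>y\<bar>) - pi / 2 * \<bar>d\<bar> * \<bar>y\<bar>)\<bar> \<le> K + \<bar>Re c - 1/2\<bar> * M + pi / 2 * B"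
      unfolding e by blast
  qed
qed

text \<open>
An estimate for large \<open>|y|\<close> suffices, since a continuous modulus is bounded on the
remaining compact interval.
\<close>

lemma line_growthI:
  assumes "g \<in> borel_measurable borel" "continuous_on UNIV (\<lambda>y. norm (g y))"
    and "\<And>y. \<bar>y\<bar> \<ge> Y \<Longrightarrow> norm (g y) \<le> exp (K + (e * ln (1 + \<bar>y\<bar>) - pi / 2 * \<delta> * \<bar>y\<bar>))"
  shows "line_growth e \<delta> g"
proof -
  define E where "E = (\<lambda>y::real. (1 + \<bar>y\<bar>) powr e * exp (- (pi / 2 * \<delta> * \<bar>y\<bar>)))"
  have Epos: "E y > 0" for y by (auto simp: E_def)
  have "continuous_on {-\<bar>Y\<bar>..\<bar>Y\<bar>} (\<lambda>y. norm (g y) / E y)"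
    unfolding E_def
    by (intro continuous_intros continuous_on_subset[OF assms(2)]) (auto simp: add_nonneg_eq_0_iff)
  hence "bounded ((\<lambda>y. norm (g y) / E y) ` {-\<bar>Y\<bar>..\<bar>Y\<bar>})"
    by (intro compact_imp_bounded compact_continuous_image) auto
  then obtain B where B: "\<And>y. y \<in> {-\<bar>Y\<bar>..\<bar>Y\<bar>} \<Longrightarrow> \<bar>norm (g y) / E y\<bar> \<le> B"
    unfolding bounded_iff by force
  have "norm (g y) \<le> max B (exp K) * E y" for y
  proof (cases "y \<in> {-\<bar>Y\<bar>..\<bar>Y\<bar>}")
    case True
    hence "norm (g y) / E y \<le> max B (exp K)" using B[OF True] by linarith
    thus ?thesis using Epos[of y] by (simp add: divide_le_eq)
  next
    case False
    hence "norm (g y) \<le> exp (K + (e * ln (1 + \<bar>y\<bar>) - pi / 2 * \<delta> * \<bar>y\<bar>))"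
      by (intro assms(3)) auto
    also have "\<dots> = exp K * E y"
    proof -
      have "1 + \<bar>y\<bar> \<noteq> 0" by linarith
      thus ?thesis by (simp add: E_def powr_def algebra_simps flip: exp_add)
    qed
    also have "\<dots> \<le> max B (exp K) * E y" using Epos[of y] by (intro mult_right_mono) auto
    finally show ?thesis .
  qed
  thus ?thesis using assms(1) unfolding line_growth_def E_def by blast
qed

text \<open>
The modulus does not depend on the branch of the power.  The equation also holds at a pole,
where both sides vanish by convention.
\<close>

lemma norm_gamma_pow:
  assumes L: "gamma_log_branch L" and s: "Re s = 0"
  shows "norm (gamma_pow L \<kappa> c d s) = norm (Gamma (c + of_real d * s)) powr \<kappa>"
proof (cases "c + of_real d * s \<in> \<int>\<^sub>\<le>\<^sub>0")
  case False
  with L s have "exp (L \<kappa> c d s) = Gamma (c + of_real d * s)"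
    unfolding gamma_log_branch_def Let_def by blast
  hence "norm (Gamma (c + of_real d * s)) = exp (Re (L \<kappa> c d s))"
    by (metis norm_exp_eq_Re)
  thus ?thesis using False by (simp add: gamma_pow_def norm_exp_eq_Re powr_def)
qed (simp add: gamma_pow_def Gamma_nonpos_Int)

lemma gamma_pow_measurable [measurable]:
  assumes L: "gamma_log_branch L"
  shows "(\<lambda>y. gamma_pow L \<kappa> c d (\<i> * of_real y)) \<in> borel_measurable borel"
proof -
  define T where "T = {y::real. c + of_real d * (\<i> * of_real y) \<in> \<int>\<^sub>\<le>\<^sub>0}"
  have "T = (\<lambda>y. c + of_real d * (\<i> * of_real y)) -` \<int>\<^sub>\<le>\<^sub>0" by (auto simp: T_def)
  hence "closed T" by (auto intro!: closed_vimage continuous_intros)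
  have "continuous_on (- T) (\<lambda>y. L \<kappa> c d (\<i> * of_real y))"
  proof (rule continuous_on_compose2[of _ "L \<kappa> c d"])
    show "continuous_on {s. Re s = 0 \<and> c + of_real d * s \<notin> \<int>\<^sub>\<le>\<^sub>0} (L \<kappa> c d)"
      using L unfolding gamma_log_branch_def Let_def by blast
  qed (auto simp: T_def intro!: continuous_intros)
  hence "(\<lambda>y. if y \<in> T then 0 else exp (of_real \<kappa> * L \<kappa> c d (\<i> * of_real y))) \<in> borel_measurable borel"
    using \<open>closed T\<close> by (intro borel_measurable_continuous_on_if) (auto intro!: continuous_intros)
  thus ?thesis by (simp add: gamma_pow_def T_def)
qed

lemma line_growth_gamma_pow:
  assumes L: "gamma_log_branch L" and d: "d \<noteq> 0"
    and np: "\<And>y::real. c + of_real d * (\<i> * of_real y) \<notin> \<int>\<^sub>\<le>\<^sub>0"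
  shows "line_growth (\<kappa> * (Re c - 1/2)) (\<kappa> * \<bar>d\<bar>) (\<lambda>y. gamma_pow L \<kappa> c d (\<i> * of_real y))"
proof -
  obtain K Y where KY: "\<And>y. \<bar>y\<bar> \<ge> Y \<Longrightarrow> \<bar>ln (norm (Gamma (c + of_real d * (\<i> * of_real y)))) -
      ((Re c - 1/2) * ln (1 + \<bar>y\<bar>) - pi / 2 * \<bar>d\<bar> * \<bar>y\<bar>)\<bar> \<le> K"
    using ln_norm_Gamma_line_approx_affine[OF d, of c] by metis
  have nz: "Gamma (c + of_real d * (\<i> * of_real y)) \<noteq> 0" for y
    using np by (simp add: Gamma_eq_zero_iff)
  show ?thesis
  proof (rule line_growthI)
    show "continuous_on UNIV (\<lambda>y. norm (gamma_pow L \<kappa> c d (\<i> * of_real y)))"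
      by (subst norm_gamma_pow[OF L]) (use np nz in \<open>auto intro!: continuous_intros continuous_on_compose2[OF continuous_on_Gamma[of "- \<int>\<^sub>\<le>\<^sub>0"]]\<close>)
    fix y assume y: "\<bar>y\<bar> \<ge> Y"
    define l where "l = ln (norm (Gamma (c + of_real d * (\<i> * of_real y))))"
    define a where "a = (Re c - 1/2) * ln (1 + \<bar>y\<bar>) - pi / 2 * \<bar>d\<bar> * \<bar>y\<bar>"
    have "\<kappa> * (l - a) \<le> \<bar>\<kappa>\<bar> * K"
      by (rule order_trans[OF abs_ge_self]) (use KY[OF y] in \<open>auto simp: abs_mult l_def a_def intro!: mult_left_mono\<close>)
    hence "\<kappa> * l \<le> \<bar>\<kappa>\<bar> * K + \<kappa> * a" by (simp add: algebra_simps)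
    moreover have "norm (gamma_pow L \<kappa> c d (\<i> * of_real y)) = exp (\<kappa> * l)"
      using nz[of y] by (subst norm_gamma_pow[OF L]) (simp_all add: powr_def l_def)
    moreover have "\<kappa> * a = \<kappa> * (Re c - 1/2) * ln (1 + \<bar>y\<bar>) - pi / 2 * (\<kappa> * \<bar>d\<bar>) * \<bar>y\<bar>"
      by (simp add: a_def algebra_simps)
    ultimately show "norm (gamma_pow L \<kappa> c d (\<i> * of_real y)) \<le>
       exp (\<bar>\<kappa>\<bar> * K + (\<kappa> * (Re c - 1/2) * ln (1 + \<bar>y\<bar>) - pi / 2 * (\<kappa> * \<bar>d\<bar>) * \<bar>y\<bar>))" by simp
  qed (use gamma_pow_measurable[OF L] in auto)
qed

text \<open>
For factors of the denominator the modulus of the reciprocal is a power of the entire function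
\<open>1/\<Gamma>\<close>.  Hence a pole of \<open>\<Gamma>\<close> on the contour is harmless: the reciprocal tends
to \<open>0\<close> there, as \<open>\<kappa> > 0\<close>.
\<close>

lemma line_growth_inverse_gamma_pow:
  assumes L: "gamma_log_branch L" and d: "d \<noteq> 0" and \<kappa>: "\<kappa> > 0"
  shows "line_growth (- (\<kappa> * (Re c - 1/2))) (- (\<kappa> * \<bar>d\<bar>)) (\<lambda>y. inverse (gamma_pow L \<kappa> c d (\<i> * of_real y)))"
proof -
  obtain K Y where KY: "\<And>y. \<bar>y\<bar> \<ge> Y \<Longrightarrow> c + of_real d * (\<i> * of_real y) \<notin> \<int>\<^sub>\<le>\<^sub>0 \<and>
    \<bar>ln (norm (Gamma (c + of_real d * (\<i> * of_real y)))) -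
      ((Re c - 1/2) * ln (1 + \<bar>y\<bar>) - pi / 2 * \<bar>d\<bar> * \<bar>y\<bar>)\<bar> \<le> K"
    using ln_norm_Gamma_line_approx_affine[OF d, of c] by metis
  have inv: "norm (inverse (gamma_pow L \<kappa> c d (\<i> * of_real y))) =
      norm (rGamma (c + of_real d * (\<i> * of_real y))) powr \<kappa>" for y
    unfolding norm_inverse by (subst norm_gamma_pow[OF L])
      (simp_all add: rGamma_inverse_Gamma norm_inverse powr_def ln_inverse exp_minus)
  show ?thesis
  proof (rule line_growthI)
    show "continuous_on UNIV (\<lambda>y. norm (inverse (gamma_pow L \<kappa> c d (\<i> * of_real y))))"
      unfolding inv by (intro continuous_on_powr' continuous_intros continuous_on_compose2[OF continuous_on_rGamma[of UNIV]]) (use \<kappa> in auto)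
    show "(\<lambda>y. inverse (gamma_pow L \<kappa> c d (\<i> * of_real y))) \<in> borel_measurable borel"
      using gamma_pow_measurable[OF L, measurable] by measurable
    fix y assume y: "\<bar>y\<bar> \<ge> Y"
    define l where "l = ln (norm (Gamma (c + of_real d * (\<i> * of_real y))))"
    define a where "a = (Re c - 1/2) * ln (1 + \<bar>y\<bar>) - pi / 2 * \<bar>d\<bar> * \<bar>y\<bar>"
    have nz: "Gamma (c + of_real d * (\<i> * of_real y)) \<noteq> 0" using KY[OF y] by (simp add: Gamma_eq_zero_iff)
    have "\<kappa> * (a - l) \<le> \<kappa> * K"
      using KY[OF y] \<kappa> unfolding abs_le_iff l_def a_def by (intro mult_left_mono) auto
    hence "- (\<kappa> * l) \<le> \<kappa> * K - \<kappa> * a" by (simp add: algebra_simps)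
    moreover have "norm (inverse (gamma_pow L \<kappa> c d (\<i> * of_real y))) = exp (- (\<kappa> * l))"
      using nz unfolding norm_inverse by (subst norm_gamma_pow[OF L]) (simp_all add: powr_def l_def exp_minus)
    moreover have "- (\<kappa> * a) = - (\<kappa> * (Re c - 1/2)) * ln (1 + \<bar>y\<bar>) - pi / 2 * (- (\<kappa> * \<bar>d\<bar>)) * \<bar>y\<bar>"
      by (simp add: a_def algebra_simps)
    ultimately show "norm (inverse (gamma_pow L \<kappa> c d (\<i> * of_real y))) \<le>
       exp (\<kappa> * K + (- (\<kappa> * (Re c - 1/2)) * ln (1 + \<bar>y\<bar>) - pi / 2 * (- (\<kappa> * \<bar>d\<bar>)) * \<bar>y\<bar>))" by simp
  qed
qed

lemma prod_list_inverse:
  "(\<Prod>x\<leftarrow>xs. inverse (f x)) = inverse (\<Prod>x\<leftarrow>xs. f x :: 'a :: field)"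
  by (induction xs) auto

lemma sum_list_take_drop:
  "(\<Sum>x\<leftarrow>xs. f x :: 'a :: comm_monoid_add) = (\<Sum>x\<leftarrow>take k xs. f x) + (\<Sum>x\<leftarrow>drop k xs. f x)"
  by (subst append_take_drop_id[of k xs, symmetric]) (simp only: map_append sum_list_append)

text \<open>
The quantities \<open>\<Omega>\<close> and \<open>\<Delta>\<close> of the convergence conditions are exactly the
sums of the exponents contributed by the single factors.
\<close>

theorem line_growth_I_chi:
  assumes L: "gamma_log_branch L" and params: "I_params m n us ls" and sep: "I_separates m n us ls"
  shows "line_growth (I_Omega us ls) (I_Delta m n us ls) (\<lambda>y. I_chi L m n us ls (\<i> * of_real y))"
proof -
  have pos_us: "A > 0 \<and> \<alpha> > 0" if "(a, A, \<alpha>) \<in> set us" for a A \<alpha>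
    using params that unfolding I_params_def by blast
  have pos_ls: "A > 0 \<and> \<alpha> > 0" if "(a, A, \<alpha>) \<in> set ls" for a A \<alpha>
    using params that unfolding I_params_def by blast
  define e1 where "e1 = (\<lambda>(b::complex, B::real, \<beta>::real). \<beta> * (Re b - 1/2))"
  define e2 where "e2 = (\<lambda>(a::complex, A::real, \<alpha>::real). \<alpha> * (Re (1 - a) - 1/2))"
  define ex where "ex = (\<lambda>(a::complex, A::real, \<alpha>::real). \<alpha> * \<bar>A\<bar>)"
  have G1: "line_growth (\<Sum>x\<leftarrow>take m ls. e1 x) (\<Sum>x\<leftarrow>take m ls. ex x)
      (\<lambda>y. \<Prod>(b, B, \<beta>)\<leftarrow>take m ls. gamma_pow L \<beta> b B (\<i> * of_real y))"
  proof (rule line_growth_prod_list)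
    fix x assume x: "x \<in> set (take m ls)"
    obtain b B \<beta> where xe: "x = (b, B, \<beta>)" by (cases x) auto
    have "b + of_real B * (\<i> * of_real y) \<notin> \<int>\<^sub>\<le>\<^sub>0" for y
      using sep x unfolding xe I_separates_def by fastforce
    moreover have "B \<noteq> 0" using pos_ls[of b B \<beta>] x xe by (auto dest: in_set_takeD)
    ultimately show "line_growth (e1 x) (ex x) (\<lambda>y. case x of (b, B, \<beta>) \<Rightarrow> gamma_pow L \<beta> b B (\<i> * of_real y))"
      using line_growth_gamma_pow[OF L, of B b \<beta>] by (simp add: xe e1_def ex_def)
  qed
  have G2: "line_growth (\<Sum>x\<leftarrow>take n us. e2 x) (\<Sum>x\<leftarrow>take n us. ex x)
      (\<lambda>y. \<Prod>(a, A, \<alpha>)\<leftarrow>take n us. gamma_pow L \<alpha> (1 - a) (- A) (\<i> * of_real y))"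
  proof (rule line_growth_prod_list)
    fix x assume x: "x \<in> set (take n us)"
    obtain b B \<beta> where xe: "x = (b, B, \<beta>)" by (cases x) auto
    have "1 - b + of_real (- B) * (\<i> * of_real y) \<notin> \<int>\<^sub>\<le>\<^sub>0" for y
      using sep x unfolding xe I_separates_def by fastforce
    moreover have "- B \<noteq> 0" using pos_us[of b B \<beta>] x xe by (auto dest: in_set_takeD)
    ultimately show "line_growth (e2 x) (ex x) (\<lambda>y. case x of (b, B, \<beta>) \<Rightarrow> gamma_pow L \<beta> (1 - b) (- B) (\<i> * of_real y))"
      using line_growth_gamma_pow[OF L, of "- B" "1 - b" \<beta>] by (simp add: xe e2_def ex_def)
  qed
  have G3: "line_growth (\<Sum>x\<leftarrow>drop m ls. - e2 x) (\<Sum>x\<leftarrow>drop m ls. - ex x)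
      (\<lambda>y. \<Prod>x\<leftarrow>drop m ls. inverse (case x of (b, B, \<beta>) \<Rightarrow> gamma_pow L \<beta> (1 - b) (- B) (\<i> * of_real y)))"
  proof (rule line_growth_prod_list)
    fix x assume x: "x \<in> set (drop m ls)"
    obtain b B \<beta> where xe: "x = (b, B, \<beta>)" by (cases x) auto
    have "- B \<noteq> 0" "\<beta> > 0" using pos_ls[of b B \<beta>] x xe by (auto dest: in_set_dropD)
    thus "line_growth (- e2 x) (- ex x) (\<lambda>y. inverse (case x of (b, B, \<beta>) \<Rightarrow> gamma_pow L \<beta> (1 - b) (- B) (\<i> * of_real y)))"
      using line_growth_inverse_gamma_pow[OF L, of "- B" \<beta> "1 - b"] by (simp add: xe e2_def ex_def)
  qed
  have G4: "line_growth (\<Sum>x\<leftarrow>drop n us. - e1 x) (\<Sum>x\<leftarrow>drop n us. - ex x)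
      (\<lambda>y. \<Prod>x\<leftarrow>drop n us. inverse (case x of (b, B, \<beta>) \<Rightarrow> gamma_pow L \<beta> b B (\<i> * of_real y)))"
  proof (rule line_growth_prod_list)
    fix x assume x: "x \<in> set (drop n us)"
    obtain b B \<beta> where xe: "x = (b, B, \<beta>)" by (cases x) auto
    have "B \<noteq> 0" "\<beta> > 0" using pos_us[of b B \<beta>] x xe by (auto dest: in_set_dropD)
    thus "line_growth (- e1 x) (- ex x) (\<lambda>y. inverse (case x of (b, B, \<beta>) \<Rightarrow> gamma_pow L \<beta> b B (\<i> * of_real y)))"
      using line_growth_inverse_gamma_pow[OF L, of B \<beta> b] by (simp add: xe e1_def ex_def)
  qed
  have neg: "(\<Sum>x\<leftarrow>xs. - f x) = - (\<Sum>x\<leftarrow>xs. f x)" for f :: "triple \<Rightarrow> real" and xs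
    by (simp add: uminus_sum_list_map o_def)
  have ex_us: "(\<Sum>x\<leftarrow>xs. ex x) = (\<Sum>(a, A, \<alpha>)\<leftarrow>xs. \<alpha> * A)" if "set xs \<subseteq> set us \<or> set xs \<subseteq> set ls" for xs
    by (intro arg_cong[of _ _ sum_list] map_cong refl)
       (use that pos_us pos_ls in \<open>fastforce simp: ex_def\<close>)
  have D: "(\<Sum>x\<leftarrow>take m ls. ex x) + (\<Sum>x\<leftarrow>take n us. ex x) + ((\<Sum>x\<leftarrow>drop m ls. - ex x) + (\<Sum>x\<leftarrow>drop n us. - ex x))
     = I_Delta m n us ls"
    unfolding neg I_Delta_def
    by (subst (1 2 3 4) ex_us) (auto dest: in_set_dropD in_set_takeD)
  have E1: "e1 = (\<lambda>x. - (case x of (b, B, \<beta>) \<Rightarrow> (1/2 - Re b) * \<beta>))"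
    and E2: "e2 = (\<lambda>x. (case x of (b, B, \<beta>) \<Rightarrow> (1/2 - Re b) * \<beta>))"
    by (auto simp: e1_def e2_def fun_eq_iff algebra_simps)
  have O: "(\<Sum>x\<leftarrow>take m ls. e1 x) + (\<Sum>x\<leftarrow>take n us. e2 x) + ((\<Sum>x\<leftarrow>drop m ls. - e2 x) + (\<Sum>x\<leftarrow>drop n us. - e1 x))
     = I_Omega us ls"
    unfolding neg E1 E2 I_Omega_def sum_list_take_drop[of _ us n] sum_list_take_drop[of _ ls m] by simp
  have "(\<lambda>y. I_chi L m n us ls (\<i> * of_real y)) = (\<lambda>y.
     ((\<Prod>(b, B, \<beta>)\<leftarrow>take m ls. gamma_pow L \<beta> b B (\<i> * of_real y)) *
      (\<Prod>(a, A, \<alpha>)\<leftarrow>take n us. gamma_pow L \<alpha> (1 - a) (- A) (\<i> * of_real y))) *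
     ((\<Prod>x\<leftarrow>drop m ls. inverse (case x of (b, B, \<beta>) \<Rightarrow> gamma_pow L \<beta> (1 - b) (- B) (\<i> * of_real y))) *
      (\<Prod>x\<leftarrow>drop n us. inverse (case x of (b, B, \<beta>) \<Rightarrow> gamma_pow L \<beta> b B (\<i> * of_real y)))))"
    unfolding I_chi_def prod_list_inverse by (simp add: field_simps)
  thus ?thesis
    using line_growth_mult[OF line_growth_mult[OF G1 G2] line_growth_mult[OF G3 G4]] unfolding D O by simp
qed

lemma set_integrable_lborel_nonneg:
  fixes g :: "real \<Rightarrow> real"
  assumes "g integrable_on S" "\<And>t. t \<in> S \<Longrightarrow> g t \<ge> 0" "S \<in> sets borel" "g \<in> borel_measurable borel"
  shows "set_integrable lborel S g"
proof -
  have "g absolutely_integrable_on S"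
    using assms by (subst absolutely_integrable_on_iff_nonneg) auto
  thus ?thesis
    using assms(3,4) unfolding set_integrable_def by (subst (asm) integrable_completion) auto
qed

lemma integrable_lborel_even:
  fixes g :: "real \<Rightarrow> real"
  assumes "set_integrable lborel {0..} g" and nonneg: "\<And>t. t \<ge> 0 \<Longrightarrow> g t \<ge> 0"
    and [measurable]: "g \<in> borel_measurable borel"
  shows "integrable lborel (\<lambda>y. g \<bar>y\<bar>)"
proof -
  have 1: "integrable lborel (\<lambda>y. indicator {0..} y *\<^sub>R g y)"
    using assms(1) unfolding set_integrable_def .
  have "integrable lborel (\<lambda>y. indicator {0..} (0 + (-1) * y) *\<^sub>R g (0 + (-1) * y))"
    by (rule lborel_integrable_real_affine[OF 1]) simp
  from Bochner_Integration.integrable_add[OF 1 this] show ?thesis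
    by (rule Bochner_Integration.integrable_bound) (auto simp: indicator_def nonneg abs_if)
qed

lemma integrable_one_plus_abs_powr:
  assumes "e < -1"
  shows "integrable lborel (\<lambda>y::real. (1 + \<bar>y\<bar>) powr e)"
proof (rule integrable_lborel_even)
  have "((\<lambda>x. x powr e) has_integral -(1 powr (e+1)) / (e+1)) {1..}"
    using assms by (intro has_integral_powr_to_inf) auto
  hence "set_integrable lborel {1..} (\<lambda>x. x powr e)"
    by (intro set_integrable_lborel_nonneg) auto
  hence "integrable lborel (\<lambda>y. indicator {1..} (1 + 1 * y) *\<^sub>R (1 + 1 * y) powr e)"
    unfolding set_integrable_def by (rule lborel_integrable_real_affine) simp
  thus "set_integrable lborel {0..} (\<lambda>x. (1 + x) powr e)"
    unfolding set_integrable_def by (simp add: indicator_def)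
qed auto

text \<open>
The factor \<open>exp (\<theta>y)\<close> is what the argument of \<open>z\<close> contributes to \<open>z\<^sup>-\<^sup>s\<close>.
In the open sector an exponential decay remains; on its boundary only the power does, which is
integrable for an exponent below \<open>-1\<close>.
\<close>

lemma integrable_line_growth:
  assumes "line_growth e \<delta> g"
    and "(\<delta> > 0 \<and> \<bar>\<theta>\<bar> < pi / 2 * \<delta>) \<or> (\<bar>\<theta>\<bar> \<le> pi / 2 * \<delta> \<and> e < -1)"
  shows "integrable lborel (\<lambda>y. g y * exp (of_real (\<theta> * y)))"
proof -
  obtain K where K: "\<And>y. norm (g y) \<le> K * ((1 + \<bar>y\<bar>) powr e * exp (- (pi / 2 * \<delta> * \<bar>y\<bar>)))"
    and [measurable]: "g \<in> borel_measurable borel"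
    using assms(1) unfolding line_growth_def by blast
  define \<epsilon> where "\<epsilon> = pi / 2 * \<delta> - \<bar>\<theta>\<bar>"
  have bnd: "norm (g y * exp (of_real (\<theta> * y))) \<le> \<bar>K\<bar> * ((1 + \<bar>y\<bar>) powr e * exp (- \<epsilon> * \<bar>y\<bar>))" for y
  proof -
    have "norm (g y * exp (of_real (\<theta> * y))) \<le> (\<bar>K\<bar> * ((1 + \<bar>y\<bar>) powr e * exp (- (pi / 2 * \<delta> * \<bar>y\<bar>)))) * exp (\<bar>\<theta>\<bar> * \<bar>y\<bar>)"
      unfolding norm_mult
    proof (rule mult_mono)
      have "K * ((1 + \<bar>y\<bar>) powr e * exp (- (pi / 2 * \<delta> * \<bar>y\<bar>))) \<le> \<bar>K\<bar> * ((1 + \<bar>y\<bar>) powr e * exp (- (pi / 2 * \<delta> * \<bar>y\<bar>)))"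
        by (intro mult_right_mono) auto
      thus "norm (g y) \<le> \<bar>K\<bar> * ((1 + \<bar>y\<bar>) powr e * exp (- (pi / 2 * \<delta> * \<bar>y\<bar>)))" using K[of y] by linarith
      show "norm (exp (of_real (\<theta> * y)) :: complex) \<le> exp (\<bar>\<theta>\<bar> * \<bar>y\<bar>)"
        by (simp add: norm_exp_eq_Re flip: abs_mult)
    qed auto
    also have "\<dots> = \<bar>K\<bar> * ((1 + \<bar>y\<bar>) powr e * exp (- \<epsilon> * \<bar>y\<bar>))"
      by (simp add: \<epsilon>_def mult.assoc flip: exp_add) (simp add: algebra_simps)
    finally show ?thesis .
  qed
  have *: "integrable lborel (\<lambda>y. \<bar>K\<bar> * ((1 + \<bar>y\<bar>) powr e * exp (- \<epsilon> * \<bar>y\<bar>)))"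
  proof (cases "e < -1 \<and> \<epsilon> \<ge> 0")
    case True
    from integrable_one_plus_abs_powr[of e] True have "integrable lborel (\<lambda>y. (1 + \<bar>y\<bar>) powr e)" by simp
    hence "integrable lborel (\<lambda>y. (1 + \<bar>y\<bar>) powr e * exp (- \<epsilon> * \<bar>y\<bar>))"
      by (rule Bochner_Integration.integrable_bound) (use True in \<open>auto intro!: AE_I2 mult_right_le_one_le simp: abs_mult\<close>)
    thus ?thesis by (intro integrable_mult_right)
  next
    case False
    hence \<epsilon>: "\<epsilon> > 0" using assms(2) unfolding \<epsilon>_def by linarith
    \<comment> \<open>chosen so that the power costs at most half of the exponential decay\<close>
    define \<eta> where "\<eta> = \<epsilon> / (2 * (\<bar>e\<bar> + 1))"
    have \<eta>: "\<eta> > 0" using \<epsilon> by (simp add: \<eta>_def)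
    define C where "C = exp (\<bar>e\<bar> * \<bar>\<eta> - 1 - ln \<eta>\<bar>)"
    have "(1 + \<bar>y\<bar>) powr e * exp (- \<epsilon> * \<bar>y\<bar>) \<le> C * exp (- (\<epsilon> / 2) * \<bar>y\<bar>)" for y :: real
    proof -
      have lm: "ln (\<eta> * (1 + \<bar>y\<bar>)) \<le> \<eta> * (1 + \<bar>y\<bar>) - 1"
        using \<eta> by (intro ln_le_minus_one) auto
      have l: "ln (1 + \<bar>y\<bar>) \<le> \<eta> * \<bar>y\<bar> + \<bar>\<eta> - 1 - ln \<eta>\<bar>"
        proof -
        have "ln (\<eta> * (1 + \<bar>y\<bar>)) = ln \<eta> + ln (1 + \<bar>y\<bar>)" using \<eta> by (intro ln_mult_pos) auto
        with lm show ?thesis by (simp add: distrib_left)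
      qed
      have "e * ln (1 + \<bar>y\<bar>) \<le> \<bar>e\<bar> * ln (1 + \<bar>y\<bar>)" by (intro mult_right_mono) auto
      also have "\<dots> \<le> \<bar>e\<bar> * (\<eta> * \<bar>y\<bar> + \<bar>\<eta> - 1 - ln \<eta>\<bar>)" using l by (intro mult_left_mono) auto
      also have "\<dots> = (\<bar>e\<bar> * \<eta>) * \<bar>y\<bar> + \<bar>e\<bar> * \<bar>\<eta> - 1 - ln \<eta>\<bar>" by (simp add: distrib_left)
      also have "\<bar>e\<bar> * \<eta> \<le> \<epsilon> / 2" using \<epsilon> by (simp add: \<eta>_def field_simps)
      hence "(\<bar>e\<bar> * \<eta>) * \<bar>y\<bar> \<le> \<epsilon> / 2 * \<bar>y\<bar>" by (intro mult_right_mono) auto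
      finally have "e * ln (1 + \<bar>y\<bar>) - \<epsilon> * \<bar>y\<bar> \<le> \<bar>e\<bar> * \<bar>\<eta> - 1 - ln \<eta>\<bar> - \<epsilon> / 2 * \<bar>y\<bar>" by simp
      hence "exp (e * ln (1 + \<bar>y\<bar>) - \<epsilon> * \<bar>y\<bar>) \<le> exp (\<bar>e\<bar> * \<bar>\<eta> - 1 - ln \<eta>\<bar> - \<epsilon> / 2 * \<bar>y\<bar>)" by simp
      moreover have "1 + \<bar>y\<bar> \<noteq> 0" by linarith
      ultimately show ?thesis by (simp add: powr_def C_def flip: exp_add)
    qed
    note b = this
    have "integrable lborel (\<lambda>y. exp (- (\<epsilon> / 2) * \<bar>y\<bar>))"
      using \<epsilon> integrable_on_exp_minus_to_infinity[of "\<epsilon> / 2" 0]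
      by (intro integrable_lborel_even set_integrable_lborel_nonneg) auto
    hence "integrable lborel (\<lambda>y. C * exp (- (\<epsilon> / 2) * \<bar>y\<bar>))" by (intro integrable_mult_right)
    hence "integrable lborel (\<lambda>y. (1 + \<bar>y\<bar>) powr e * exp (- \<epsilon> * \<bar>y\<bar>))"
      by (rule Bochner_Integration.integrable_bound) (use b in \<open>auto simp: C_def\<close>)
    thus ?thesis by (intro integrable_mult_right)
  qed
  show ?thesis
    by (rule Bochner_Integration.integrable_bound[OF *]) (use bnd in \<open>auto intro!: order_trans[OF _ abs_ge_self]\<close>)
qed

section \<open>Gauss's summation theorem\<close>

lemma Re_pos_not_nonpos_Ints: "Re z > 0 \<Longrightarrow> z \<notin> \<int>\<^sub>\<le>\<^sub>0"
  by (auto elim!: nonpos_Ints_cases simp: complex_eq_iff)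

lemma pochhammer_Re_pos_nonzero: "Re z > 0 \<Longrightarrow> pochhammer z k \<noteq> 0"
  using Re_pos_not_nonpos_Ints[of z] by (auto simp: pochhammer_eq_0_iff)

text \<open>
This is Gauss's product for \<open>1/\<Gamma>\<close>, with the normalisation
\<open>k! (k + 1)\<^sup>z\<^sup>-\<^sup>1\<close> that makes sense from \<open>k = 0\<close> on.
\<close>

lemma norm_pochhammer_asymptotics:
  fixes z :: complex
  shows "(\<lambda>k. norm (pochhammer z k) / (fact k * (real k + 1) powr (Re z - 1))) \<longlonglongrightarrow> norm (rGamma z)"
proof (rule LIMSEQ_imp_Suc)
  have "(\<lambda>n. real n powr x / ((real n + 1) * (real n + 2) powr (x - 1))) \<longlonglongrightarrow> 1" for x :: real
    by real_asymp
  from tendsto_mult[OF tendsto_norm[OF rGamma_series_LIMSEQ[of z]] this[of "Re z"]]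
  have "(\<lambda>n. norm (rGamma_series z n) * (real n powr Re z / ((real n + 1) * (real n + 2) powr (Re z - 1)))) \<longlonglongrightarrow> norm (rGamma z)"
    by simp
  moreover have "eventually (\<lambda>n. norm (rGamma_series z n) * (real n powr Re z / ((real n + 1) * (real n + 2) powr (Re z - 1))) =
    norm (pochhammer z (Suc n)) / (fact (Suc n) * (real (Suc n) + 1) powr (Re z - 1))) sequentially"
    using eventually_gt_at_top[of 0]
  proof eventually_elim
    case (elim n)
    have "norm (exp (z * of_real (ln (real n)))) = real n powr Re z"
      using elim by (simp add: norm_exp_eq_Re powr_def)
    hence rG: "norm (rGamma_series z n) = norm (pochhammer z (Suc n)) / (fact n * real n powr Re z)"
      by (simp add: rGamma_series_def norm_divide norm_mult)
    define B where "B = (real n + 2) powr (Re z - 1)"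
    have "P / (f * X) * (X / (N * B)) = P / (N * f * B)" if "X > 0" for P f X N :: real
      using that by simp
    from this[of "real n powr Re z"] elim
    have "norm (rGamma_series z n) * (real n powr Re z / ((real n + 1) * B)) =
        norm (pochhammer z (Suc n)) / ((real n + 1) * fact n * B)" unfolding rG by simp
    thus ?case by (simp add: B_def add_ac)
  qed
  ultimately show "(\<lambda>n. norm (pochhammer z (Suc n)) / (fact (Suc n) * (real (Suc n) + 1) powr (Re z - 1))) \<longlonglongrightarrow> norm (rGamma z)"
    by (rule Lim_transform_eventually)
qed

lemma norm_pochhammer_upper:
  fixes z :: complex
  obtains K where "K > 0" "\<And>k. norm (pochhammer z k) \<le> K * (fact k * (real k + 1) powr (Re z - 1))"
proof -
  from convergentI[OF norm_pochhammer_asymptotics[of z], THEN convergent_imp_Bseq] obtain K where "K > 0"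
    and K: "\<forall>k. norm (norm (pochhammer z k) / (fact k * (real k + 1) powr (Re z - 1))) \<le> K"
    by (rule BseqE)
  have "norm (pochhammer z k) \<le> K * (fact k * (real k + 1) powr (Re z - 1))" for k
  proof -
    have "fact k * (real k + 1) powr (Re z - 1) > (0::real)" by simp
    thus ?thesis using K[rule_format, of k] by (simp add: divide_le_eq)
  qed
  with \<open>K > 0\<close> show ?thesis by (rule that)
qed

lemma norm_pochhammer_lower:
  fixes z :: complex
  assumes "z \<notin> \<int>\<^sub>\<le>\<^sub>0"
  obtains K where "K > 0" "\<And>k. fact k * (real k + 1) powr (Re z - 1) \<le> K * norm (pochhammer z k)"
proof -
  have "norm (rGamma z) \<noteq> 0" using assms by (simp add: rGamma_eq_zero_iff)
  from convergentI[OF tendsto_inverse[OF norm_pochhammer_asymptotics[of z] this], THEN convergent_imp_Bseq] obtain K where "K > 0"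
    and K: "\<forall>k. norm (inverse (norm (pochhammer z k) / (fact k * (real k + 1) powr (Re z - 1)))) \<le> K"
    by (rule BseqE)
  have "fact k * (real k + 1) powr (Re z - 1) \<le> K * norm (pochhammer z k)" for k
  proof -
    have "norm (pochhammer z k) > 0" using assms by (auto simp: pochhammer_eq_0_iff)
    thus ?thesis using K[rule_format, of k] by (simp add: divide_le_eq)
  qed
  with \<open>K > 0\<close> show ?thesis by (rule that)
qed

text \<open>
The Taylor coefficients of \<open>\<^sub>2F\<^sub>1(a, b; c; z)\<close> at \<open>0\<close>.
\<close>

definition hyp_coeff :: "complex \<Rightarrow> complex \<Rightarrow> complex \<Rightarrow> nat \<Rightarrow> complex" where
  "hyp_coeff a b c k = pochhammer a k * pochhammer b k / (pochhammer c k * fact k)"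

lemma norm_hyp_coeff_le:
  assumes c: "c \<notin> \<int>\<^sub>\<le>\<^sub>0"
  obtains K where "K > 0" "\<And>k. norm (hyp_coeff a b c k) \<le> K * (real k + 1) powr (Re (a + b - c) - 1)"
proof -
  obtain A where A: "A > 0" "\<And>k. norm (pochhammer a k) \<le> A * (fact k * (real k + 1) powr (Re a - 1))"
    using norm_pochhammer_upper by blast
  obtain B where B: "B > 0" "\<And>k. norm (pochhammer b k) \<le> B * (fact k * (real k + 1) powr (Re b - 1))"
    using norm_pochhammer_upper by blast
  obtain C where C: "C > 0" "\<And>k. fact k * (real k + 1) powr (Re c - 1) \<le> C * norm (pochhammer c k)"
    using norm_pochhammer_lower[OF c] by blast
  have "norm (hyp_coeff a b c k) \<le> (A * B * C) * (real k + 1) powr (Re (a + b - c) - 1)" for k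
  proof -
    have cpos: "norm (pochhammer c k) > 0" using c by (auto simp: pochhammer_eq_0_iff)
    have "norm (hyp_coeff a b c k) * (fact k * (real k + 1) powr (Re c - 1)) \<le> norm (hyp_coeff a b c k) * (C * norm (pochhammer c k))"
      by (intro mult_left_mono C) auto
    also have "\<dots> = C * (norm (pochhammer a k) * norm (pochhammer b k)) / fact k"
      using cpos by (simp add: hyp_coeff_def norm_mult norm_divide field_simps)
    also have "\<dots> \<le> C * ((A * (fact k * (real k + 1) powr (Re a - 1))) * (B * (fact k * (real k + 1) powr (Re b - 1)))) / fact k"
      using A B C by (intro divide_right_mono mult_left_mono mult_mono) auto
    also have "\<dots> = (A * B * C) * ((real k + 1) powr (Re a - 1) * (real k + 1) powr (Re b - 1)) * fact k"
      by (simp add: field_simps)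
    also have "(real k + 1) powr (Re a - 1) * (real k + 1) powr (Re b - 1) =
       (real k + 1) powr (Re (a + b - c) - 1) * (real k + 1) powr (Re c - 1)"
      unfolding powr_add[symmetric] by (simp add: algebra_simps)
    finally have "norm (hyp_coeff a b c k) * (fact k * (real k + 1) powr (Re c - 1)) \<le>
      ((A * B * C) * (real k + 1) powr (Re (a + b - c) - 1)) * (fact k * (real k + 1) powr (Re c - 1))"
      by (simp add: mult_ac)
    thus ?thesis by (rule mult_right_le_imp_le) simp
  qed
  moreover have "A * B * C > 0" using A B C by simp
  ultimately show ?thesis using that by blast
qed

lemma summable_Suc_powr: "p < -1 \<Longrightarrow> summable (\<lambda>k. (real k + 1) powr p)"
  using summable_Suc_iff[of "\<lambda>k. real k powr p"] summable_real_powr_iff[of p] by (simp add: add.commute)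

lemma summable_norm_hyp_coeff:
  assumes "c \<notin> \<int>\<^sub>\<le>\<^sub>0" "Re (c - a - b) > 0"
  shows "summable (\<lambda>k. norm (hyp_coeff a b c k))"
proof -
  obtain K where "\<And>k. norm (hyp_coeff a b c k) \<le> K * (real k + 1) powr (Re (a + b - c) - 1)"
    using norm_hyp_coeff_le[OF assms(1)] by blast
  thus ?thesis using assms(2)
    by (intro summable_comparison_test[OF _ summable_mult[OF summable_Suc_powr, of _ K]]) auto
qed

lemma summable_hyp_coeff_power:
  assumes "c \<notin> \<int>\<^sub>\<le>\<^sub>0" "0 < r" "r < (1::real)"
  shows "summable (\<lambda>k. norm (hyp_coeff a b c k) * r ^ k)"
proof -
  obtain K where K: "\<And>k. norm (hyp_coeff a b c k) \<le> K * (real k + 1) powr (Re (a + b - c) - 1)"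
    using norm_hyp_coeff_le[OF assms(1)] by blast
  have *: "(\<lambda>k. (real k + 1) powr p * r ^ k) \<in> O(\<lambda>k. (real k + 1) powr (-2))" for p
    using assms(2,3) by real_asymp
  have "summable (\<lambda>k. (real k + 1) powr p * r ^ k)" for p
    by (rule summable_comparison_test_bigo[OF _ *]) (use summable_Suc_powr[of "-2"] in auto)
  from summable_mult[OF this, of K]
  have "summable (\<lambda>k. K * ((real k + 1) powr (Re (a + b - c) - 1) * r ^ k))" .
  thus ?thesis
    by (rule summable_comparison_test[rotated])
       (use K assms in \<open>auto simp: abs_mult simp flip: mult.assoc intro!: mult_right_mono exI[of _ 0]\<close>)
qed

text \<open>
Gauss's contiguity relation between \<open>c\<close> and \<open>c + 1\<close> at the point \<open>1\<close>, in
telescoping form: with \<open>t\<^sub>k\<close> the coefficients for \<open>c\<close>, the difference of the two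
sides of the relation is the increment of \<open>c k t\<^sub>k\<close>.
\<close>

lemma hyp_coeff_contiguous:
  assumes c: "c \<notin> \<int>\<^sub>\<le>\<^sub>0"
  shows "(c - a) * (c - b) * hyp_coeff a b (c + 1) k - c * (c - a - b) * hyp_coeff a b c k =
     c * (of_nat (Suc k) * hyp_coeff a b c (Suc k)) - c * (of_nat k * hyp_coeff a b c k)"
proof -
  have ck: "c + of_nat k \<noteq> 0" "c \<noteq> 0" for k using c by (auto simp: add_eq_0_iff2)
  have pk: "pochhammer c k \<noteq> 0" using c by (auto simp: pochhammer_eq_0_iff)
  have "c * pochhammer (c + 1) k = (c + of_nat k) * pochhammer c k"
    by (metis pochhammer_rec pochhammer_rec')
  hence p1: "pochhammer (c + 1) k = (c + of_nat k) * pochhammer c k / c"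
    using ck by (simp add: field_simps)
  define t where "t = hyp_coeff a b c k"
  have t1: "hyp_coeff a b (c + 1) k = t * (c / (c + of_nat k))"
    unfolding hyp_coeff_def t_def p1 using ck pk by (simp add: field_simps)
  have t2: "of_nat (Suc k) * hyp_coeff a b c (Suc k) = t * ((a + of_nat k) * (b + of_nat k) / (c + of_nat k))"
  proof -
    have "X * (A * P * (B * Q) / (C * R * (X * F))) = P * Q / (R * F) * (A * B / C)"
      if "X \<noteq> 0" for X A B C P Q R F :: complex using that by (simp add: mult_ac)
    moreover have "of_nat (Suc k) \<noteq> (0::complex)" by (simp del: of_nat_Suc)
    ultimately show ?thesis unfolding hyp_coeff_def t_def pochhammer_rec' fact_Suc of_nat_mult of_nat_fact
      by blast
  qed
  have "(c - a) * (c - b) / (c + of_nat k) - (c - a - b) = (a + of_nat k) * (b + of_nat k) / (c + of_nat k) - of_nat k"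
    using ck(1)[of k] by (simp add: field_simps)
  hence "c * t * ((c - a) * (c - b) / (c + of_nat k) - (c - a - b)) = c * t * ((a + of_nat k) * (b + of_nat k) / (c + of_nat k) - of_nat k)"
    by simp
  thus ?thesis unfolding t1 t2 t_def[symmetric] by (simp add: divide_inverse algebra_simps)
qed

text \<open>
The telescoping sum has no boundary term at infinity: \<open>k t\<^sub>k\<close> is of order
\<open>k\<^sup>p\<close> with \<open>p = Re (a + b - c) < 0\<close>.
\<close>

lemma suminf_hyp_coeff_contiguous:
  assumes c: "Re c > 0" "Re (c - a - b) > 0"
  shows "(c - a) * (c - b) * (\<Sum>k. hyp_coeff a b (c + 1) k) = c * (c - a - b) * (\<Sum>k. hyp_coeff a b c k)"
proof -
  have ni: "c \<notin> \<int>\<^sub>\<le>\<^sub>0" "c + 1 \<notin> \<int>\<^sub>\<le>\<^sub>0" using c by (auto elim!: nonpos_Ints_cases simp: complex_eq_iff)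
  have s1: "summable (hyp_coeff a b (c + 1))" and s0: "summable (hyp_coeff a b c)"
    using c ni by (auto intro!: summable_norm_cancel[OF summable_norm_hyp_coeff])
  obtain K where K: "\<And>k. norm (hyp_coeff a b c k) \<le> K * (real k + 1) powr (Re (a + b - c) - 1)"
    using norm_hyp_coeff_le[OF ni(1)] by blast
  have "(\<lambda>k. of_nat k * hyp_coeff a b c k) \<longlonglongrightarrow> 0"
  proof (rule Lim_null_comparison)
    show "eventually (\<lambda>k. norm (of_nat k * hyp_coeff a b c k) \<le> K * (real k * (real k + 1) powr (Re (a + b - c) - 1))) sequentially"
      using K by (auto intro!: always_eventually mult_left_mono simp: norm_mult mult.left_commute[of K])
    have "(\<lambda>k. K * (real k * (real k + 1) powr (p - 1))) \<longlonglongrightarrow> 0" if "p < 0" for p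
      using that by real_asymp
    thus "(\<lambda>k. K * (real k * (real k + 1) powr (Re (a + b - c) - 1))) \<longlonglongrightarrow> 0" using c by simp
  qed
  hence "(\<lambda>k. c * (of_nat k * hyp_coeff a b c k)) \<longlonglongrightarrow> c * 0" by (intro tendsto_intros)
  from telescope_sums[OF this]
  have "(\<lambda>k. c * (of_nat (Suc k) * hyp_coeff a b c (Suc k)) - c * (of_nat k * hyp_coeff a b c k)) sums 0" by simp
  hence "(\<lambda>k. (c - a) * (c - b) * hyp_coeff a b (c + 1) k - c * (c - a - b) * hyp_coeff a b c k) sums 0"
    by (simp only: hyp_coeff_contiguous[OF ni(1)])
  moreover have "(\<lambda>k. (c - a) * (c - b) * hyp_coeff a b (c + 1) k - c * (c - a - b) * hyp_coeff a b c k) sums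
     ((c - a) * (c - b) * (\<Sum>k. hyp_coeff a b (c + 1) k) - c * (c - a - b) * (\<Sum>k. hyp_coeff a b c k))"
    by (intro sums_diff sums_mult summable_sums s0 s1)
  ultimately show ?thesis using sums_unique2 by fastforce
qed

lemma suminf_hyp_coeff_shift:
  assumes c: "Re c > 0" "Re (c - a - b) > 0"
  shows "pochhammer (c - a) n * pochhammer (c - b) n * (\<Sum>k. hyp_coeff a b (c + of_nat n) k) =
     pochhammer c n * pochhammer (c - a - b) n * (\<Sum>k. hyp_coeff a b c k)"
proof (induction n)
  case (Suc n)
  have "(c + of_nat n - a) * (c + of_nat n - b) * (\<Sum>k. hyp_coeff a b (c + of_nat n + 1) k) =
    (c + of_nat n) * (c + of_nat n - a - b) * (\<Sum>k. hyp_coeff a b (c + of_nat n) k)"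
    using c by (intro suminf_hyp_coeff_contiguous) auto
  hence *: "(c - a + of_nat n) * (c - b + of_nat n) * (\<Sum>k. hyp_coeff a b (c + of_nat (Suc n)) k) =
    (c + of_nat n) * (c - a - b + of_nat n) * (\<Sum>k. hyp_coeff a b (c + of_nat n) k)"
    by (simp add: algebra_simps)
  have "pochhammer (c - a) (Suc n) * pochhammer (c - b) (Suc n) * (\<Sum>k. hyp_coeff a b (c + of_nat (Suc n)) k) =
    pochhammer (c - a) n * pochhammer (c - b) n * ((c - a + of_nat n) * (c - b + of_nat n) * (\<Sum>k. hyp_coeff a b (c + of_nat (Suc n)) k))"
    by (simp add: pochhammer_rec' mult_ac)
  also have "\<dots> = (c + of_nat n) * (c - a - b + of_nat n) * (pochhammer (c - a) n * pochhammer (c - b) n * (\<Sum>k. hyp_coeff a b (c + of_nat n) k))"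
    unfolding * by (simp add: mult_ac)
  also have "\<dots> = pochhammer c (Suc n) * pochhammer (c - a - b) (Suc n) * (\<Sum>k. hyp_coeff a b c k)"
    unfolding Suc.IH by (simp add: pochhammer_rec' mult_ac)
  finally show ?case .
qed simp

lemma norm_pochhammer_mono:
  assumes "Re c > 0"
  shows "norm (pochhammer c k) \<le> norm (pochhammer (c + of_nat n) k)"
  unfolding pochhammer_prod prod_norm[symmetric]
proof (rule prod_mono, safe)
  fix i
  have "(Re c + real i)\<^sup>2 \<le> (Re c + real n + real i)\<^sup>2" using assms by (intro power_mono) auto
  thus "norm (c + of_nat i) \<le> norm (c + of_nat n + of_nat i)" by (simp add: cmod_def)
qed auto

text \<open>
As \<open>c + n\<close> grows, all terms but the first tend to \<open>0\<close>.  In the right half-plane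
moving \<open>c\<close> to the right increases every \<open>|c + i|\<close>, so the series at \<open>c\<close>
dominates all the others and Tannery's theorem applies.
\<close>

lemma suminf_hyp_coeff_LIMSEQ:
  assumes c: "Re c > 0" "Re (c - a - b) > 0"
  shows "(\<lambda>n. \<Sum>k. hyp_coeff a b (c + of_nat n) k) \<longlonglongrightarrow> 1"
proof -
  have ni: "c \<notin> \<int>\<^sub>\<le>\<^sub>0" using c by (auto elim!: nonpos_Ints_cases)
  define b' where "b' = (\<lambda>k::nat. if k = 0 then 1 else (0::complex))"
  have "((\<lambda>n. \<Sum>k. hyp_coeff a b (c + of_nat n) k) \<longlonglongrightarrow> (\<Sum>k. b' k))"
  proof (rule tannerys_theorem[THEN conjunct2, THEN conjunct2])
    show "(\<lambda>n. hyp_coeff a b (c + of_nat n) k) \<longlonglongrightarrow> b' k" for k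
    proof (cases k)
      case 0
      thus ?thesis by (simp add: b'_def hyp_coeff_def)
    next
      case (Suc j)
      have "filterlim (\<lambda>n. c + of_nat n) at_infinity sequentially"
        by (intro tendsto_add_filterlim_at_infinity[OF tendsto_const] tendsto_of_nat)
      hence inv0: "(\<lambda>n. inverse (c + of_nat n)) \<longlonglongrightarrow> 0"
        by (rule filterlim_compose[OF tendsto_inverse_0])
      have "(\<lambda>n. norm (pochhammer a k * pochhammer b k / fact k) / norm (pochhammer (c + 1) j) * norm (inverse (c + of_nat n)))
        \<longlonglongrightarrow> norm (pochhammer a k * pochhammer b k / fact k) / norm (pochhammer (c + 1) j) * norm (0::complex)"
        by (intro tendsto_intros inv0)
      hence lim: "(\<lambda>n. norm (pochhammer a k * pochhammer b k / fact k) / norm (pochhammer (c + 1) j) * norm (inverse (c + of_nat n)))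
        \<longlonglongrightarrow> 0" by simp
      have bnd: "norm (hyp_coeff a b (c + of_nat n) k) \<le>
        norm (pochhammer a k * pochhammer b k / fact k) / norm (pochhammer (c + 1) j) * norm (inverse (c + of_nat n))" for n
      proof -
        have "norm (pochhammer (c + 1) j) \<le> norm (pochhammer (c + 1 + of_nat n) j)"
          using c by (intro norm_pochhammer_mono) auto
        moreover have "pochhammer (c + 1) j \<noteq> 0"
          using c by (intro pochhammer_Re_pos_nonzero) auto
        ultimately have "inverse (norm (pochhammer (c + 1 + of_nat n) j)) \<le> inverse (norm (pochhammer (c + 1) j))"
          by (intro le_imp_inverse_le) auto
        hence "norm (pochhammer a k * pochhammer b k / fact k) * norm (inverse (c + of_nat n)) * inverse (norm (pochhammer (c + 1 + of_nat n) j)) \<le>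
          norm (pochhammer a k * pochhammer b k / fact k) * norm (inverse (c + of_nat n)) * inverse (norm (pochhammer (c + 1) j))"
          by (intro mult_left_mono) auto
        moreover have "pochhammer (c + of_nat n) k = (c + of_nat n) * pochhammer (c + 1 + of_nat n) j"
          unfolding Suc pochhammer_rec by (simp add: add_ac)
        ultimately show ?thesis
          by (simp add: hyp_coeff_def norm_mult norm_divide norm_inverse divide_inverse mult_ac)
      qed
      have "(\<lambda>n. hyp_coeff a b (c + of_nat n) k) \<longlonglongrightarrow> 0"
        by (rule Lim_null_comparison[OF always_eventually[OF allI[OF bnd]] lim])
      thus ?thesis by (simp add: b'_def Suc)
    qed
    show "eventually (\<lambda>(k, n). norm (hyp_coeff a b (c + of_nat n) k) \<le> norm (hyp_coeff a b c k)) (at_top \<times>\<^sub>F sequentially)"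
    proof (intro always_eventually allI, clarify)
      fix k n :: nat
      have "pochhammer c k \<noteq> 0" using ni by (auto simp: pochhammer_eq_0_iff)
      thus "norm (hyp_coeff a b (c + of_nat n) k) \<le> norm (hyp_coeff a b c k)"
        unfolding hyp_coeff_def norm_divide norm_mult
        by (intro divide_left_mono mult_right_mono mult_pos_pos norm_pochhammer_mono[OF c(1)])
           (use pochhammer_Re_pos_nonzero[of "c + of_nat n" k] c in auto)
    qed
    show "summable (\<lambda>k. norm (hyp_coeff a b c k))" by (rule summable_norm_hyp_coeff[OF ni c(2)])
  qed simp
  also have "(\<Sum>k. b' k) = 1"
    unfolding b'_def by (subst suminf_finite[of "{0}"]) auto
  finally show ?thesis .
qed

text \<open>
Gauss's theorem \<open>\<^sub>2F\<^sub>1(a, b; c; 1) = \<Gamma>(c) \<Gamma>(c - a - b) / (\<Gamma>(c - a) \<Gamma>(c - b))\<close>.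
Iterating the contiguity relation relates the value at \<open>c\<close> to that at \<open>c + n\<close> by a
quotient of four Pochhammer symbols; by Gauss's product this quotient converges to the stated
Gamma quotient while the value at \<open>c + n\<close> tends to \<open>1\<close>.
\<close>

theorem gauss_hypergeometric_sum:
  assumes c: "Re c > 0" "Re (c - a - b) > 0"
  shows "hyp_coeff a b c sums (Gamma c * Gamma (c - a - b) * rGamma (c - a) * rGamma (c - b))"
proof -
  have ni: "c \<notin> \<int>\<^sub>\<le>\<^sub>0" "c - a - b \<notin> \<int>\<^sub>\<le>\<^sub>0" using c by (auto intro!: Re_pos_not_nonpos_Ints)
  have summ: "summable (hyp_coeff a b c)"
    using c ni by (auto intro!: summable_norm_cancel[OF summable_norm_hyp_coeff])
  let ?S = "\<Sum>k. hyp_coeff a b c k"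
  have "(\<lambda>n. rGamma_series (c - a) n * rGamma_series (c - b) n * (\<Sum>k. hyp_coeff a b (c + of_nat (Suc n)) k))
    \<longlonglongrightarrow> rGamma (c - a) * rGamma (c - b) * 1"
    by (intro tendsto_intros LIMSEQ_Suc[OF suminf_hyp_coeff_LIMSEQ[OF c]])
  moreover have "(\<lambda>n. rGamma_series (c - a) n * rGamma_series (c - b) n * (\<Sum>k. hyp_coeff a b (c + of_nat (Suc n)) k)) =
    (\<lambda>n. rGamma_series c n * rGamma_series (c - a - b) n * ?S)"
  proof
    fix n
    define E where "E = (\<lambda>z. fact n * exp (z * of_real (ln (real n))) :: complex)"
    have E: "E z \<noteq> 0" for z by (simp add: E_def)
    have EE: "E (c - a) * E (c - b) = E c * E (c - a - b)"
      by (simp add: E_def algebra_simps flip: exp_add)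
    have "rGamma_series (c - a) n * rGamma_series (c - b) n * (\<Sum>k. hyp_coeff a b (c + of_nat (Suc n)) k) =
      (pochhammer (c - a) (Suc n) * pochhammer (c - b) (Suc n) * (\<Sum>k. hyp_coeff a b (c + of_nat (Suc n)) k)) / (E (c - a) * E (c - b))"
      by (simp add: rGamma_series_def E_def)
    also have "\<dots> = rGamma_series c n * rGamma_series (c - a - b) n * ?S"
      unfolding suminf_hyp_coeff_shift[OF c] EE by (simp add: rGamma_series_def E_def)
    finally show "rGamma_series (c - a) n * rGamma_series (c - b) n * (\<Sum>k. hyp_coeff a b (c + of_nat (Suc n)) k) =
      rGamma_series c n * rGamma_series (c - a - b) n * ?S" .
  qed
  moreover have "(\<lambda>n. rGamma_series c n * rGamma_series (c - a - b) n * ?S) \<longlonglongrightarrow> rGamma c * rGamma (c - a - b) * ?S"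
    by (intro tendsto_intros)
  ultimately have "rGamma c * rGamma (c - a - b) * ?S = rGamma (c - a) * rGamma (c - b)"
    using LIMSEQ_unique by fastforce
  moreover have "rGamma c \<noteq> 0" "rGamma (c - a - b) \<noteq> 0" using ni by (auto simp: rGamma_eq_zero_iff)
  ultimately have "?S = Gamma c * Gamma (c - a - b) * rGamma (c - a) * rGamma (c - b)"
    by (simp add: Gamma_def field_simps)
  with summ show ?thesis by (simp add: sums_iff)
qed

section \<open>The beta integral on a ray\<close>

lemma measurable_powr_complex [measurable (raw)]:
  fixes f :: "'a \<Rightarrow> real" and z :: complex
  assumes [measurable]: "f \<in> borel_measurable M"
  shows "(\<lambda>x. complex_of_real (f x) powr z) \<in> borel_measurable M"
  unfolding powr_def by measurable

text \<open>
Used when the modulus of an integrand is again an integrand of the same kind, with its complex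
exponents replaced by their real parts: then no separate real-valued evaluation is needed.
\<close>

lemma set_integral_norm_eq:
  fixes f g :: "_ \<Rightarrow> complex"
  assumes "A \<in> sets M" "\<And>t. t \<in> A \<Longrightarrow> g t = of_real (norm (f t))"
  shows "(LINT t:A|M. norm (f t)) = norm (LINT t:A|M. g t)"
proof -
  have "(LINT t:A|M. g t) = (LINT t:A|M. of_real (norm (f t)))"
    using assms by (intro set_lebesgue_integral_cong) auto
  also have "\<dots> = of_real (LINT t:A|M. norm (f t))" by (rule set_integral_complex_of_real)
  finally have "norm (LINT t:A|M. g t) = \<bar>LINT t:A|M. norm (f t)\<bar>" by simp
  moreover have "(LINT t:A|M. norm (f t)) \<ge> 0"
    unfolding set_lebesgue_integral_def by (intro Bochner_Integration.integral_nonneg) auto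
  ultimately show ?thesis by simp
qed

lemma norm_of_real_powr: "x > 0 \<Longrightarrow> norm (complex_of_real x powr z) = x powr Re z"
  by (simp add: norm_powr_real_powr)

lemma Gamma_laplace:
  assumes z: "Re z > 0" and u: "u > (0::real)"
  shows "set_integrable lborel {0<..} (\<lambda>t. of_real t powr (z - 1) * of_real (exp (- u * t)))"
    and "(LINT t:{0<..}|lborel. of_real t powr (z - 1) * of_real (exp (- u * t))) = Gamma z * of_real u powr (- z)"
proof -
  define f where "f = (\<lambda>t. indicator {0<..} t *\<^sub>R (complex_of_real t powr (z - 1) / of_real (exp t)))"
  have ai: "(\<lambda>t. complex_of_real t powr (z - 1) / of_real (exp t)) absolutely_integrable_on {0<..}"
    by (rule absolutely_integrable_Gamma_integral'[OF z])
  have f: "integrable lborel f"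
    using ai unfolding set_integrable_def f_def by (subst (asm) integrable_completion) auto
  have "integral\<^sup>L lborel f = (LINT t:{0<..}|lebesgue. complex_of_real t powr (z - 1) / of_real (exp t))"
    unfolding set_lebesgue_integral_def f_def by (subst integral_completion) auto
  also have "\<dots> = integral {0<..} (\<lambda>t. complex_of_real t powr (z - 1) / of_real (exp t))"
    by (rule set_lebesgue_integral_eq_integral[OF ai])
  also have "\<dots> = Gamma z" by (rule integral_unique[OF Gamma_integral_complex'[OF z]])
  finally have If: "integral\<^sup>L lborel f = Gamma z" .
  have eq: "f (0 + u * t) = indicator {0<..} t *\<^sub>R (of_real u powr (z - 1) * (of_real t powr (z - 1) * of_real (exp (- u * t))))" for t
    using u by (auto simp: f_def indicator_def zero_less_mult_iff powr_times_real exp_minus field_simps)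
  have nz: "complex_of_real u powr (z - 1) \<noteq> 0" using u by simp
  have "integrable lborel (\<lambda>t. f (0 + u * t))" using u by (intro lborel_integrable_real_affine f) auto
  hence "set_integrable lborel {0<..} (\<lambda>t. of_real u powr (z - 1) * (of_real t powr (z - 1) * of_real (exp (- u * t))))"
    unfolding eq set_integrable_def .
  thus "set_integrable lborel {0<..} (\<lambda>t. of_real t powr (z - 1) * of_real (exp (- u * t)))"
    by (simp only: set_integrable_mult_right_iff[OF nz])
  have "Gamma z = \<bar>u\<bar> *\<^sub>R (\<integral>t. f (0 + u * t) \<partial>lborel)"
    unfolding If[symmetric] using u by (intro lborel_integral_real_affine) auto
  also have "\<dots> = of_real u * (LINT t:{0<..}|lborel. of_real u powr (z - 1) * (of_real t powr (z - 1) * of_real (exp (- u * t))))"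
    unfolding eq set_lebesgue_integral_def using u by (simp add: scaleR_conv_of_real)
  also have "\<dots> = of_real u * (of_real u powr (z - 1) * (LINT t:{0<..}|lborel. of_real t powr (z - 1) * of_real (exp (- u * t))))"
    by (simp only: set_integral_mult_right)
  also have "\<dots> = of_real u powr z * (LINT t:{0<..}|lborel. of_real t powr (z - 1) * of_real (exp (- u * t)))"
    using u by (simp add: powr_diff)
  finally show "(LINT t:{0<..}|lborel. of_real t powr (z - 1) * of_real (exp (- u * t))) = Gamma z * of_real u powr (- z)"
    using u by (simp add: powr_minus field_simps)
qed

lemma Gamma_laplace_shifted:
  assumes z: "Re z > 0" and u: "u > (0::real)"
  shows "set_integrable lborel {x<..} (\<lambda>t. of_real (t - x) powr (z - 1) * of_real (exp (- u * t)))"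
    and "(LINT t:{x<..}|lborel. of_real (t - x) powr (z - 1) * of_real (exp (- u * t))) =
           Gamma z * of_real u powr (- z) * of_real (exp (- u * x))"
proof -
  have eq: "indicator {x<..} (x + 1 * t) *\<^sub>R (complex_of_real (x + 1 * t - x) powr (z - 1) * of_real (exp (- u * (x + 1 * t)))) =
    indicator {0<..} t *\<^sub>R (of_real (exp (- u * x)) * (complex_of_real t powr (z - 1) * of_real (exp (- u * t))))" for t
    by (simp add: indicator_def algebra_simps exp_diff exp_minus field_simps flip: of_real_add)
  have "integrable lborel (\<lambda>t. indicator {x<..} (x + 1 * t) *\<^sub>R (complex_of_real (x + 1 * t - x) powr (z - 1) * of_real (exp (- u * (x + 1 * t)))))"
    unfolding eq using set_integrable_mult_right[OF Gamma_laplace(1)[OF assms]] unfolding set_integrable_def by blast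
  thus "set_integrable lborel {x<..} (\<lambda>t. of_real (t - x) powr (z - 1) * of_real (exp (- u * t)))"
    unfolding set_integrable_def by (subst (asm) lborel_integrable_real_affine_iff) auto
  show "(LINT t:{x<..}|lborel. of_real (t - x) powr (z - 1) * of_real (exp (- u * t))) =
           Gamma z * of_real u powr (- z) * of_real (exp (- u * x))"
  proof -
    have "(LINT t:{x<..}|lborel. of_real (t - x) powr (z - 1) * of_real (exp (- u * t))) =
      (LINT t:{0<..}|lborel. of_real (exp (- u * x)) * (complex_of_real t powr (z - 1) * of_real (exp (- u * t))))"
      unfolding set_lebesgue_integral_def by (subst lborel_integral_real_affine[of 1 _ x], simp, unfold eq) simp
    also have "\<dots> = of_real (exp (- u * x)) * (Gamma z * of_real u powr (- z))"
      by (simp only: set_integral_mult_right Gamma_laplace(2)[OF assms])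
    finally show ?thesis by simp
  qed
qed

lemma norm_Gamma_laplace_shifted:
  assumes z: "Re z > 0" and u: "u > (0::real)"
  shows "(LINT t:{x<..}|lborel. norm (complex_of_real (t - x) powr (z - 1) * of_real (exp (- u * t)))) =
           norm (Gamma (complex_of_real (Re z))) * u powr (- Re z) * exp (- u * x)"
proof -
  have "(LINT t:{x<..}|lborel. norm (complex_of_real (t - x) powr (z - 1) * of_real (exp (- u * t)))) =
    norm (LINT t:{x<..}|lborel. complex_of_real (t - x) powr (of_real (Re z) - 1) * of_real (exp (- u * t)))"
  proof (rule set_integral_norm_eq)
    fix t assume "t \<in> {x<..}"
    thus "of_real (t - x) powr (of_real (Re z) - 1) * of_real (exp (- u * t)) =
        complex_of_real (norm (complex_of_real (t - x) powr (z - 1) * of_real (exp (- u * t))))"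
      using powr_of_real[of "t - x" "Re z - 1"] norm_of_real_powr[of "t - x" "z - 1"] by (simp add: norm_mult)
  qed simp
  also have "\<dots> = norm (Gamma (complex_of_real (Re z)) * of_real u powr (- of_real (Re z)) * of_real (exp (- u * x)))"
    using z u by (subst Gamma_laplace_shifted(2)) auto
  finally show ?thesis using u by (simp add: norm_mult norm_of_real_powr)
qed

text \<open>
The substitution \<open>t = x/u\<close> turns this into Euler's beta integral.  It is evaluated here by
Fubini's theorem for
\<open>u\<^sup>p\<^sup>+\<^sup>q\<^sup>-\<^sup>1 (t - x)\<^sup>p\<^sup>-\<^sup>1 exp (-ut)\<close> on \<open>u > 0\<close>,
\<open>t > x\<close>, since both partial integrals are Laplace transforms of powers.
\<close>

lemma Beta_integral_ray:
  fixes x :: real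
  assumes p: "Re p > 0" and q: "Re q > 0" and x: "x > 0"
  shows "set_integrable lborel {x<..} (\<lambda>t. of_real (t - x) powr (p - 1) * of_real t powr (- p - q))"
    and "(LINT t:{x<..}|lborel. of_real (t - x) powr (p - 1) * of_real t powr (- p - q)) =
           of_real x powr (- q) * Gamma p * Gamma q * rGamma (p + q)"
proof -
  define F where "F = (\<lambda>u t. indicator {0<..} u *\<^sub>R (indicator {x<..} t *\<^sub>R (complex_of_real u powr (p + q - 1) *
     (of_real (t - x) powr (p - 1) * of_real (exp (- u * t))))))"
  have F_meas [measurable]: "case_prod F \<in> borel_measurable (lborel \<Otimes>\<^sub>M lborel)"
    unfolding F_def by measurable
  have int_t: "integrable lborel (F u)" for u
  proof (cases "u > 0")
    case True
    from set_integrable_mult_right[OF Gamma_laplace_shifted(1)[OF p True, of x]] show ?thesis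
      unfolding F_def set_integrable_def by (intro integrable_scaleR_right) blast
  qed (simp add: F_def)
  have val_t: "(\<integral>t. F u t \<partial>lborel) = indicator {0<..} u *\<^sub>R (Gamma p * (of_real u powr (q - 1) * of_real (exp (- x * u))))" for u
  proof (cases "u > 0")
    case True
    have "(\<integral>t. F u t \<partial>lborel) = (LINT t:{x<..}|lborel. complex_of_real u powr (p + q - 1) *
       (of_real (t - x) powr (p - 1) * of_real (exp (- u * t))))"
      unfolding F_def set_lebesgue_integral_def using True by (intro Bochner_Integration.integral_cong) auto
    also have "\<dots> = of_real u powr (p + q - 1) * (Gamma p * of_real u powr (- p) * of_real (exp (- u * x)))"
      by (simp only: set_integral_mult_right Gamma_laplace_shifted(2)[OF p True])
    also have "\<dots> = Gamma p * (of_real u powr (p + q - 1) * of_real u powr (- p)) * of_real (exp (- u * x))" by simp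
    also have "of_real u powr (p + q - 1) * of_real u powr (- p) = complex_of_real u powr (q - 1)"
      unfolding powr_add[symmetric] by simp
    finally show ?thesis using True by (simp add: mult_ac)
  qed (simp add: F_def)
  have nval_t: "(\<integral>t. norm (F u t) \<partial>lborel) = norm (norm (Gamma (complex_of_real (Re p))) *\<^sub>R
      (indicator {0<..} u *\<^sub>R (of_real u powr (q - 1) * complex_of_real (exp (- x * u)))))" for u
  proof (cases "u > 0")
    case True
    have "(\<integral>t. norm (F u t) \<partial>lborel) = (LINT t:{x<..}|lborel. norm (complex_of_real u powr (p + q - 1)) *
       norm (complex_of_real (t - x) powr (p - 1) * of_real (exp (- u * t))))"
      unfolding F_def set_lebesgue_integral_def using True
      by (intro Bochner_Integration.integral_cong) (auto simp: norm_mult)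
    also have "\<dots> = norm (complex_of_real u powr (p + q - 1)) *
      (norm (Gamma (complex_of_real (Re p))) * u powr (- Re p) * exp (- u * x))"
      by (simp only: set_integral_mult_right norm_Gamma_laplace_shifted[OF p True])
    also have "\<dots> = norm (Gamma (complex_of_real (Re p))) * (u powr (Re (p + q - 1)) * u powr (- Re p)) * exp (- u * x)"
      using True by (simp add: norm_of_real_powr)
    also have "u powr (Re (p + q - 1)) * u powr (- Re p) = u powr (Re (q - 1))"
      unfolding powr_add[symmetric] by simp
    finally show ?thesis using True by (simp add: norm_mult norm_of_real_powr mult_ac)
  qed (simp add: F_def)
  have lap: "integrable lborel (\<lambda>u. indicator {0<..} u *\<^sub>R (of_real u powr (q - 1) * complex_of_real (exp (- x * u))))"
    using Gamma_laplace(1)[OF q x] unfolding set_integrable_def .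
  have intF: "integrable (lborel \<Otimes>\<^sub>M lborel) (case_prod F)"
  proof (rule lborel_pair.Fubini_integrable)
    show "integrable lborel (\<lambda>u. \<integral>t. norm (case_prod F (u, t)) \<partial>lborel)"
      unfolding prod.case nval_t by (intro integrable_norm integrable_scaleR_right lap)
  qed (use int_t in auto)
  have val_u: "(\<integral>u. F u t \<partial>lborel) = indicator {x<..} t *\<^sub>R (Gamma (p + q) * (of_real (t - x) powr (p - 1) * of_real t powr (- p - q)))" for t
  proof (cases "t > x")
    case True
    hence t: "t > 0" using x by simp
    have "(\<integral>u. F u t \<partial>lborel) = (LINT u:{0<..}|lborel. of_real (t - x) powr (p - 1) * (complex_of_real u powr (p + q - 1) * of_real (exp (- t * u))))"
      unfolding F_def set_lebesgue_integral_def using True by (intro Bochner_Integration.integral_cong) (auto simp: mult_ac)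
    also have "\<dots> = of_real (t - x) powr (p - 1) * (Gamma (p + q) * of_real t powr (- (p + q)))"
      using p q t by (subst set_integral_mult_right, subst Gamma_laplace(2)) auto
    finally show ?thesis using True by (simp add: mult_ac)
  qed (simp add: F_def)
  have Gpq: "Gamma (p + q) \<noteq> 0" using p q by (simp add: Gamma_eq_zero_iff Re_pos_not_nonpos_Ints)
  have "integrable lborel (\<lambda>t. \<integral>u. F u t \<partial>lborel)"
    using lborel_pair.integrable_snd[OF intF] .
  hence "set_integrable lborel {x<..} (\<lambda>t. Gamma (p + q) * (of_real (t - x) powr (p - 1) * of_real t powr (- p - q)))"
    unfolding val_u set_integrable_def .
  thus "set_integrable lborel {x<..} (\<lambda>t. of_real (t - x) powr (p - 1) * of_real t powr (- p - q))"
    by (simp only: set_integrable_mult_right_iff[OF Gpq])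
  have "Gamma (p + q) * (LINT t:{x<..}|lborel. of_real (t - x) powr (p - 1) * of_real t powr (- p - q)) =
    (LINT t:{x<..}|lborel. Gamma (p + q) * (of_real (t - x) powr (p - 1) * of_real t powr (- p - q)))"
    by (rule set_integral_mult_right[symmetric])
  also have "\<dots> = (\<integral>t. \<integral>u. F u t \<partial>lborel \<partial>lborel)"
    unfolding val_u set_lebesgue_integral_def ..
  also have "\<dots> = (\<integral>u. \<integral>t. F u t \<partial>lborel \<partial>lborel)"
    by (rule lborel_pair.Fubini_integral[OF intF])
  also have "\<dots> = (LINT u:{0<..}|lborel. Gamma p * (of_real u powr (q - 1) * of_real (exp (- x * u))))"
    unfolding val_t set_lebesgue_integral_def ..
  also have "\<dots> = Gamma p * (Gamma q * of_real x powr (- q))"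
    by (simp only: set_integral_mult_right Gamma_laplace(2)[OF q x])
  finally show "(LINT t:{x<..}|lborel. of_real (t - x) powr (p - 1) * of_real t powr (- p - q)) =
           of_real x powr (- q) * Gamma p * Gamma q * rGamma (p + q)"
    using Gpq by (simp add: rGamma_inverse_Gamma field_simps)
qed

lemma norm_Beta_integral_ray:
  fixes x :: real
  assumes p: "Re p > 0" and q: "Re q > 0" and x: "x > 0"
  shows "(LINT t:{x<..}|lborel. norm (complex_of_real (t - x) powr (p - 1) * of_real t powr (- p - q))) =
    x powr (- Re q) * norm (Gamma (complex_of_real (Re p)) * Gamma (complex_of_real (Re q)) * rGamma (complex_of_real (Re p + Re q)))"
proof -
  have "(LINT t:{x<..}|lborel. norm (complex_of_real (t - x) powr (p - 1) * of_real t powr (- p - q))) =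
    norm (LINT t:{x<..}|lborel. complex_of_real (t - x) powr (of_real (Re p) - 1) * of_real t powr (- of_real (Re p) - of_real (Re q)))"
  proof (rule set_integral_norm_eq)
    fix t assume "t \<in> {x<..}"
    thus "of_real (t - x) powr (of_real (Re p) - 1) * of_real t powr (- of_real (Re p) - of_real (Re q)) =
        complex_of_real (norm (complex_of_real (t - x) powr (p - 1) * of_real t powr (- p - q)))"
      using x powr_of_real[of "t - x" "Re p - 1"] norm_of_real_powr[of "t - x" "p - 1"]
        powr_of_real[of t "- Re p - Re q"] norm_of_real_powr[of t "- p - q"] by (simp add: norm_mult)
  qed simp
  also have "\<dots> = norm (complex_of_real x powr (- of_real (Re q)) * Gamma (of_real (Re p)) * Gamma (of_real (Re q)) * rGamma (of_real (Re p) + of_real (Re q)))"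
    using p q x by (subst Beta_integral_ray(2)) auto
  finally show ?thesis using x by (simp add: norm_mult norm_of_real_powr mult.assoc)
qed

section \<open>The Mellin transform of the hypergeometric kernel\<close>

lemma hyp2F1_eq_suminf: "hyp2F1 a b c z = (\<Sum>k. hyp_coeff a b c k * z ^ k)"
  unfolding hyp2F1_def eval_fps_def by (simp add: hyp_coeff_def)

text \<open>
Expanding \<open>\<^sub>2F\<^sub>1\<close> in powers of \<open>1 - x/t = (t - x)/t\<close> gives beta integrals with
\<open>c + k\<close> in place of \<open>c\<close>.  Their values multiply the coefficients by
\<open>(c)\<^sub>k/(c + s)\<^sub>k\<close>, up to a constant, which turns the series into
\<open>\<^sub>2F\<^sub>1(a, b; c + s; 1)\<close>, and Gauss's theorem sums it.  The interchange is justified by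
absolute values: these terms are of order
\<open>k\<^sup>p\<close> with \<open>p = Re (a + b - c - s) - 1 < -1\<close>.
\<close>

theorem hypergeometric_kernel_mellin:
  fixes x :: real
  assumes c: "Re c > 0" and s: "Re s > 0" and sc: "Re (s + c - a - b) > 0" and x: "x > 0"
  defines "K \<equiv> \<lambda>t. of_real (t - x) powr (c - 1) * of_real t powr (- c - s) * hyp2F1 a b c (of_real (1 - x / t))"
  shows "set_integrable lborel {x<..} K"
    and "(LINT t:{x<..}|lborel. K t) =
      of_real x powr (- s) * Gamma c * Gamma s * Gamma (s + c - a - b) * rGamma (s + c - a) * rGamma (s + c - b)"
proof -
  have ni: "c \<notin> \<int>\<^sub>\<le>\<^sub>0" using c by (rule Re_pos_not_nonpos_Ints)
  define B where "B = (\<lambda>k t. complex_of_real (t - x) powr (c + of_nat k - 1) * of_real t powr (- (c + of_nat k) - s))"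
  define f where "f = (\<lambda>k t. indicator {x<..} t *\<^sub>R (hyp_coeff a b c k * B k t))"
  have ck: "Re (c + of_nat k) > 0" for k using c by simp
  have B_eq: "B k t = of_real (t - x) powr (c - 1) * of_real t powr (- c - s) * of_real (1 - x / t) ^ k" if t: "t > x" for k t
  proof -
    have t0: "t > 0" using t x by simp
    have "B k t = of_real (t - x) powr (c - 1) * of_real (t - x) powr (of_nat k) * (of_real t powr (- c - s) * of_real t powr (- of_nat k))"
      unfolding B_def powr_add[symmetric] by (simp add: algebra_simps)
    also have "of_real (t - x) powr (of_nat k :: complex) = of_real (t - x) ^ k"
      using t by (intro powr_nat') (auto simp flip: of_real_diff)
    also have "of_real t powr (- of_nat k :: complex) = inverse (of_real t ^ k)"
      using t0 by (simp add: powr_minus powr_nat')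
    also have "complex_of_real (1 - x / t) = of_real (t - x) * inverse (of_real t)"
      using t0 by (simp add: field_simps)
    ultimately show ?thesis by (simp only: power_mult_distrib power_inverse mult_ac)
  qed
  have f_eq: "f k t = (indicator {x<..} t *\<^sub>R (of_real (t - x) powr (c - 1) * of_real t powr (- c - s))) * (hyp_coeff a b c k * of_real (1 - x / t) ^ k)" for k t
    using B_eq[of t k] by (auto simp: f_def indicator_def mult_ac)
  have summ_r: "summable (\<lambda>k. norm (hyp_coeff a b c k * complex_of_real (1 - x / t) ^ k))" if "t > x" for t
  proof -
    have "0 < 1 - x / t" "1 - x / t < 1" using that x by (auto simp: field_simps)
    from summable_hyp_coeff_power[OF ni this, of a b] this show ?thesis
      by (simp add: norm_mult norm_power del: of_real_diff of_real_divide)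
  qed
  have int: "integrable lborel (f k)" for k
    unfolding f_def using set_integrable_mult_right[OF Beta_integral_ray(1)[OF ck s x, of k]] unfolding B_def set_integrable_def
    by blast
  have AE_summ: "AE t in lborel. summable (\<lambda>k. norm (f k t))"
  proof (rule AE_I2)
    fix t :: real
    show "summable (\<lambda>k. norm (f k t))"
    proof (cases "t > x")
      case True
      thus ?thesis unfolding f_eq norm_mult[of "indicator {x<..} t *\<^sub>R _"] by (intro summable_mult summ_r)
    qed (simp add: f_def)
  qed
  define G where "G = norm (Gamma (complex_of_real (Re c)) * Gamma (complex_of_real (Re s)) * rGamma (complex_of_real (Re c + Re s)))"
  have norm_int: "(\<integral>t. norm (f k t) \<partial>lborel) = x powr (- Re s) * G *
      (norm (hyp_coeff a b c k) * norm (pochhammer (complex_of_real (Re c)) k) / norm (pochhammer (complex_of_real (Re c + Re s)) k))" for k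
  proof -
    have "(\<integral>t. norm (f k t) \<partial>lborel) = (LINT t:{x<..}|lborel. norm (hyp_coeff a b c k) * norm (B k t))"
      unfolding f_def set_lebesgue_integral_def by (intro Bochner_Integration.integral_cong) (auto simp: norm_mult)
    also have "\<dots> = norm (hyp_coeff a b c k) * (LINT t:{x<..}|lborel. norm (B k t))"
      by (rule set_integral_mult_right)
    also have "(LINT t:{x<..}|lborel. norm (B k t)) = x powr (- Re s) * norm (Gamma (complex_of_real (Re (c + of_nat k))) *
       Gamma (complex_of_real (Re s)) * rGamma (complex_of_real (Re (c + of_nat k) + Re s)))"
      unfolding B_def by (rule norm_Beta_integral_ray[OF ck s x])
    also have "complex_of_real (Re (c + of_nat k)) = of_real (Re c) + of_nat k" by simp
    also have "Gamma (complex_of_real (Re c) + of_nat k) = Gamma (of_real (Re c)) * pochhammer (of_real (Re c)) k"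
      using c by (subst pochhammer_Gamma) (auto simp: Re_pos_not_nonpos_Ints Gamma_eq_zero_iff)
    also have "complex_of_real (Re (c + of_nat k) + Re s) = of_real (Re c + Re s) + of_nat k" by simp
    also have "rGamma (complex_of_real (Re c + Re s) + of_nat k) = rGamma (of_real (Re c + Re s)) / pochhammer (of_real (Re c + Re s)) k"
      using c s by (subst pochhammer_rGamma[of _ k]) (auto simp: pochhammer_Re_pos_nonzero)
    finally show ?thesis by (simp add: G_def norm_mult norm_divide mult_ac)
  qed
  have summ_int: "summable (\<lambda>k. \<integral>t. norm (f k t) \<partial>lborel)"
  proof -
    obtain K1 where K1: "K1 > 0" "\<And>k. norm (hyp_coeff a b c k) \<le> K1 * (real k + 1) powr (Re (a + b - c) - 1)"
      using norm_hyp_coeff_le[OF ni] by blast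
    \<comment> \<open>the quotient \<open>(c)\<^sub>k/(c + s)\<^sub>k\<close> is itself a coefficient with first parameter \<open>1\<close>, as \<open>(1)\<^sub>k = k!\<close>\<close>
    obtain K2 where K2: "K2 > 0" "\<And>k. norm (hyp_coeff 1 (of_real (Re c)) (of_real (Re c + Re s)) k) \<le>
        K2 * (real k + 1) powr (Re (1 + of_real (Re c) - of_real (Re c + Re s)) - 1)"
      using norm_hyp_coeff_le[OF Re_pos_not_nonpos_Ints[of "of_real (Re c + Re s)"], of 1 "of_real (Re c)"] c s by auto
    have coeff: "norm (hyp_coeff 1 (of_real (Re c)) (of_real (Re c + Re s)) k) =
      norm (pochhammer (complex_of_real (Re c)) k) / norm (pochhammer (complex_of_real (Re c + Re s)) k)" for k
      by (simp add: hyp_coeff_def norm_divide norm_mult pochhammer_fact[symmetric])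
    have bnd: "norm (norm (hyp_coeff a b c k) * norm (pochhammer (complex_of_real (Re c)) k) / norm (pochhammer (complex_of_real (Re c + Re s)) k))
      \<le> K1 * K2 * (real k + 1) powr (Re (a + b - c - s) - 1)" for k
    proof -
      have "norm (norm (hyp_coeff a b c k) * norm (pochhammer (complex_of_real (Re c)) k) / norm (pochhammer (complex_of_real (Re c + Re s)) k))
        = norm (hyp_coeff a b c k) * norm (hyp_coeff 1 (of_real (Re c)) (of_real (Re c + Re s)) k)"
        unfolding coeff by simp
      also have "\<dots> \<le> (K1 * (real k + 1) powr (Re (a + b - c) - 1)) * (K2 * (real k + 1) powr (Re (1 + of_real (Re c) - of_real (Re c + Re s)) - 1))"
        using K1 K2 by (intro mult_mono) auto
      also have "\<dots> = K1 * K2 * ((real k + 1) powr (Re (a + b - c) - 1) * (real k + 1) powr (Re (1 + of_real (Re c) - of_real (Re c + Re s)) - 1))"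
        by (simp add: mult_ac)
      also have "(real k + 1) powr (Re (a + b - c) - 1) * (real k + 1) powr (Re (1 + of_real (Re c) - of_real (Re c + Re s)) - 1) =
         (real k + 1) powr (Re (a + b - c - s) - 1)"
        unfolding powr_add[symmetric] by (simp add: algebra_simps)
      finally show ?thesis .
    qed
    have "summable (\<lambda>k. K1 * K2 * (real k + 1) powr (Re (a + b - c - s) - 1))"
      using sc by (intro summable_mult summable_Suc_powr) simp
    from summable_comparison_test'[OF this bnd]
    have "summable (\<lambda>k. norm (hyp_coeff a b c k) * norm (pochhammer (complex_of_real (Re c)) k) / norm (pochhammer (complex_of_real (Re c + Re s)) k))"
      by simp
    thus ?thesis unfolding norm_int by (rule summable_mult)
  qed
  have K_eq: "(\<Sum>k. f k t) = indicator {x<..} t *\<^sub>R K t" for t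
  proof (cases "t > x")
    case True
    hence "(\<Sum>k. f k t) = of_real (t - x) powr (c - 1) * of_real t powr (- c - s) * (\<Sum>k. hyp_coeff a b c k * of_real (1 - x / t) ^ k)"
      unfolding f_eq using summable_norm_cancel[OF summ_r[OF True]] by (subst suminf_mult) auto
    thus ?thesis using True by (simp add: K_def hyp2F1_eq_suminf)
  qed (simp add: f_def)
  show "set_integrable lborel {x<..} K"
    using integrable_suminf[OF int AE_summ summ_int] unfolding K_eq set_integrable_def .
  have val: "(\<integral>t. f k t \<partial>lborel) = of_real x powr (- s) * Gamma s * Gamma c * rGamma (c + s) * hyp_coeff a b (c + s) k" for k
  proof -
    have "(\<integral>t. f k t \<partial>lborel) = (LINT t:{x<..}|lborel. hyp_coeff a b c k * B k t)"
      unfolding f_def set_lebesgue_integral_def by (intro Bochner_Integration.integral_cong) auto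
    also have "\<dots> = hyp_coeff a b c k * (LINT t:{x<..}|lborel. B k t)"
      by (rule set_integral_mult_right)
    also have "(LINT t:{x<..}|lborel. B k t) = of_real x powr (- s) * Gamma (c + of_nat k) * Gamma s * rGamma (c + of_nat k + s)"
      unfolding B_def by (rule Beta_integral_ray(2)[OF ck s x])
    also have "Gamma (c + of_nat k) = Gamma c * pochhammer c k"
      using c ni by (subst pochhammer_Gamma) (auto simp: Gamma_eq_zero_iff)
    also have "c + of_nat k + s = c + s + of_nat k" by simp
    also have "rGamma (c + s + of_nat k) = rGamma (c + s) / pochhammer (c + s) k"
      using c s by (subst pochhammer_rGamma[of _ k]) (auto simp: pochhammer_Re_pos_nonzero)
    finally show ?thesis using pochhammer_Re_pos_nonzero[OF c, of k] by (simp add: hyp_coeff_def mult_ac)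
  qed
  have "(LINT t:{x<..}|lborel. K t) = (\<Sum>k. \<integral>t. f k t \<partial>lborel)"
    using integral_suminf[OF int AE_summ summ_int] unfolding K_eq set_lebesgue_integral_def .
  also have "\<dots> = of_real x powr (- s) * Gamma s * Gamma c * rGamma (c + s) * (\<Sum>k. hyp_coeff a b (c + s) k)"
    unfolding val using gauss_hypergeometric_sum[of "c + s" a b] c s sc
    by (intro suminf_mult) (auto simp: algebra_simps sums_iff)
  also have "(\<Sum>k. hyp_coeff a b (c + s) k) = Gamma (c + s) * Gamma (c + s - a - b) * rGamma (c + s - a) * rGamma (c + s - b)"
    using gauss_hypergeometric_sum[of "c + s" a b] c s sc by (simp add: algebra_simps sums_iff)
  also have "Gamma (c + s) = inverse (rGamma (c + s))" by (simp add: Gamma_def)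
  finally show "(LINT t:{x<..}|lborel. K t) =
      of_real x powr (- s) * Gamma c * Gamma s * Gamma (s + c - a - b) * rGamma (s + c - a) * rGamma (s + c - b)"
    using c s Re_pos_not_nonpos_Ints[of "c + s"] by (simp add: rGamma_eq_zero_iff add.commute[of s c] field_simps)
qed

section \<open>Derivatives of superpositions of powers\<close>

text \<open>
By the mean value theorem the difference quotients are bounded by the majorant of the derivative,
so dominated convergence applies along every sequence of increments.
\<close>

lemma has_vector_derivative_integral_dominated:
  fixes F F' :: "real \<Rightarrow> 'a \<Rightarrow> complex"
  assumes r: "r > 0"
    and int: "\<And>x. \<bar>x - x0\<bar> < r \<Longrightarrow> integrable M (F x)"
    and der: "\<And>x y. \<bar>x - x0\<bar> < r \<Longrightarrow> ((\<lambda>x. F x y) has_vector_derivative F' x y) (at x)"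
    and int': "integrable M (F' x0)"
    and B: "integrable M B" "\<And>x y. \<bar>x - x0\<bar> < r \<Longrightarrow> norm (F' x y) \<le> B y"
  shows "((\<lambda>x. \<integral>y. F x y \<partial>M) has_vector_derivative (\<integral>y. F' x0 y \<partial>M)) (at x0)"
  unfolding has_vector_derivative_def has_derivative_at
proof (intro conjI bounded_linear_scaleR_left)
  define R where "R = (\<lambda>h y. F (x0 + h) y - F x0 y - h *\<^sub>R F' x0 y)"
  have R_bound: "norm (R h y) \<le> \<bar>h\<bar> * (2 * B y)" if h: "\<bar>h\<bar> < r" for h y
  proof -
    have "norm (F (x0 + h) y - F x0 y - ((x0 + h) - x0) *\<^sub>R F' x0 y) \<le> norm ((x0 + h) - x0) * (2 * B y)"
    proof (rule vector_differentiable_bound_linearization[where S = "{x. \<bar>x - x0\<bar> < r}"])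
      fix x assume "x \<in> {x. \<bar>x - x0\<bar> < r}"
      thus "((\<lambda>x. F x y) has_vector_derivative F' x y) (at x within {x. \<bar>x - x0\<bar> < r})"
        using der has_vector_derivative_at_within by blast
      show "norm (F' x y - F' x0 y) \<le> 2 * B y"
        using norm_triangle_ineq4[of "F' x y" "F' x0 y"] B(2)[of x y] B(2)[of x0 y] r \<open>x \<in> _\<close> by simp
    next
      show "closed_segment x0 (x0 + h) \<subseteq> {x. \<bar>x - x0\<bar> < r}"
        using h by (auto simp: closed_segment_eq_real_ivl split: if_splits)
    qed (use r in auto)
    thus ?thesis by (simp add: R_def)
  qed
  have R_lim: "((\<lambda>h. norm (R h y) / norm h) \<longlongrightarrow> 0) (at 0)" for y
    using der[of x0 y] r unfolding has_vector_derivative_def has_derivative_at R_def by simp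
  have R_int: "(\<integral>y. F (x0 + h) y \<partial>M) - (\<integral>y. F x0 y \<partial>M) - h *\<^sub>R (\<integral>y. F' x0 y \<partial>M) = (\<integral>y. R h y \<partial>M)"
    and R_integrable: "integrable M (R h)" if "\<bar>h\<bar> < r" for h
    unfolding R_def using int[of "x0 + h"] int[of x0] int' that r by auto
  show "((\<lambda>h. norm ((\<integral>y. F (x0 + h) y \<partial>M) - (\<integral>y. F x0 y \<partial>M) - h *\<^sub>R (\<integral>y. F' x0 y \<partial>M)) / norm h) \<longlongrightarrow> 0) (at 0)"
  proof (subst tendsto_at_iff_sequentially, intro allI impI)
    fix X :: "nat \<Rightarrow> real" assume X: "\<forall>i. X i \<in> UNIV - {0}" "X \<longlonglongrightarrow> 0"
    define q where "q = (\<lambda>n y. if \<bar>X n\<bar> < r then inverse (X n) *\<^sub>R R (X n) y else 0)"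
    have X_small: "eventually (\<lambda>n. \<bar>X n\<bar> < r) sequentially"
      using tendstoD[OF X(2) r] by (simp add: dist_real_def)
    have "(\<lambda>n. \<integral>y. q n y \<partial>M) \<longlonglongrightarrow> (\<integral>y. 0 \<partial>M)"
    proof (rule integral_dominated_convergence)
      show "q n \<in> borel_measurable M" for n
        using R_integrable[of "X n"] by (cases "\<bar>X n\<bar> < r") (auto simp: q_def)
      show "integrable M (\<lambda>y. 2 * B y)" using B(1) by simp
      show "AE y in M. norm (q n y) \<le> 2 * B y" for n
      proof (rule AE_I2)
        fix y
        have "B y \<ge> 0" using order_trans[OF norm_ge_zero B(2)[of x0 y]] r by simp
        moreover have "norm (R (X n) y) / \<bar>X n\<bar> \<le> 2 * B y" if "\<bar>X n\<bar> < r"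
          using R_bound[OF that, of y] X(1) by (simp add: divide_le_eq mult.commute)
        ultimately show "norm (q n y) \<le> 2 * B y" by (auto simp: q_def divide_inverse mult.commute)
      qed
      show "AE y in M. (\<lambda>n. q n y) \<longlonglongrightarrow> 0"
      proof (rule AE_I2)
        fix y
        have "(\<lambda>n. norm (R (X n) y) / norm (X n)) \<longlonglongrightarrow> 0"
          using R_lim[of y] X unfolding tendsto_at_iff_sequentially o_def by blast
        hence "(\<lambda>n. norm (q n y)) \<longlonglongrightarrow> 0"
          by (rule Lim_transform_eventually) (use X_small in \<open>eventually_elim, simp add: q_def divide_inverse mult.commute\<close>)
        thus "(\<lambda>n. q n y) \<longlonglongrightarrow> 0" by (rule tendsto_norm_zero_cancel)
      qed
    qed simp
    hence "(\<lambda>n. norm (\<integral>y. q n y \<partial>M)) \<longlonglongrightarrow> 0" by (simp add: tendsto_norm_zero_iff)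
    thus "((\<lambda>h. norm ((\<integral>y. F (x0 + h) y \<partial>M) - (\<integral>y. F x0 y \<partial>M) - h *\<^sub>R (\<integral>y. F' x0 y \<partial>M)) / norm h) \<circ> X) \<longlonglongrightarrow> 0"
    proof (rule Lim_transform_eventually)
      show "eventually (\<lambda>n. norm (\<integral>y. q n y \<partial>M) = ((\<lambda>h. norm ((\<integral>y. F (x0 + h) y \<partial>M) - (\<integral>y. F x0 y \<partial>M) - h *\<^sub>R (\<integral>y. F' x0 y \<partial>M)) / norm h) \<circ> X) n) sequentially"
        using X_small
      proof eventually_elim
        case (elim n)
        hence "(\<integral>y. q n y \<partial>M) = inverse (X n) *\<^sub>R (\<integral>y. R (X n) y \<partial>M)" by (simp add: q_def)
        thus ?case using R_int[OF elim] by (simp add: divide_inverse mult.commute)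
      qed
    qed
  qed
qed

lemma has_vector_derivative_of_real_powr:
  assumes "x > 0"
  shows "((\<lambda>x. complex_of_real x powr z) has_vector_derivative z * of_real x powr (z - 1)) (at x)"
proof -
  have "((\<lambda>s. s powr z) has_field_derivative z * of_real x powr (z - 1)) (at (complex_of_real x))"
    using assms by (auto intro!: derivative_eq_intros simp: complex_nonpos_Reals_iff)
  from has_vector_derivative_real_field[OF this] show ?thesis .
qed

lemma neg_deriv_eq:
  assumes "(f has_vector_derivative D) (at x)"
  shows "neg_deriv f x = - D"
  using assms by (simp add: neg_deriv_def vector_derivative_at)

lemma norm_pochhammer_ge_Re:
  assumes "Re z > 0"
  shows "norm (pochhammer z k) \<ge> pochhammer (Re z) k"
  unfolding pochhammer_prod prod_norm[symmetric]
  by (rule prod_mono) (use assms abs_Re_le_cmod[of "z + of_nat _"] in \<open>auto intro: order_trans[OF _ complex_Re_le_cmod]\<close>)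

text \<open>
A superposition of powers \<open>x\<^sup>-\<^sup>w\<close> is differentiated under the integral sign, each
derivative contributing the next factor of the Pochhammer symbol of \<open>w\<close>.  Only the
integrability after the last derivative has to be assumed: all \<open>w\<close> have the same positive
real part \<open>\<omega>\<close>, so the missing factors \<open>w + k, \<dots>\<close> are bounded away from
\<open>0\<close>, and the modulus of \<open>x\<^sup>-\<^sup>w\<close> does not depend on \<open>y\<close>.
\<close>

lemma neg_deriv_funpow_power_mixture:
  fixes g w :: "real \<Rightarrow> complex"
  assumes Re_w: "\<And>y. Re (w y) = \<omega>" "\<omega> > 0"
    and [measurable]: "g \<in> borel_measurable borel" "w \<in> borel_measurable borel"
    and int: "integrable lborel (\<lambda>y. g y * pochhammer (w y) N)"
    and J: "\<And>x. x > 0 \<Longrightarrow> J x = (\<integral>y. g y * of_real x powr (- w y) \<partial>lborel)"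
  shows "k \<le> N \<Longrightarrow> x > 0 \<Longrightarrow> (neg_deriv ^^ k) J x =
           (\<integral>y. g y * pochhammer (w y) k * of_real x powr (- w y - of_nat k) \<partial>lborel)"
    and "k < N \<Longrightarrow> x > 0 \<Longrightarrow> (neg_deriv ^^ k) J differentiable (at x)"
proof -
  define H where "H = (\<lambda>k x y. g y * pochhammer (w y) k * complex_of_real x powr (- w y - of_nat k))"
  have norm_powr: "norm (complex_of_real x powr (- w y - of_nat k)) = x powr (- \<omega> - real k)" if "x > 0" for x y k
    using that by (simp add: norm_of_real_powr Re_w)
  have poch_meas [measurable]: "(\<lambda>y. pochhammer (w y) k) \<in> borel_measurable borel" for k
    unfolding pochhammer_prod by measurable
  have powr_meas [measurable]: "(\<lambda>y. complex_of_real x powr (- w y - of_nat k)) \<in> borel_measurable borel" for x k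
    unfolding powr_def by measurable
  have int_poch: "integrable lborel (\<lambda>y. g y * pochhammer (w y) k)" if "k \<le> N" for k
  proof -
    define P where "P = pochhammer (\<omega> + real k) (N - k)"
    have P: "P > 0" unfolding P_def using Re_w(2) by (intro pochhammer_pos) auto
    have "P * norm (pochhammer (w y) k) \<le> norm (pochhammer (w y) N)" for y
    proof -
      have "pochhammer (w y) N = pochhammer (w y) k * pochhammer (w y + of_nat k) (N - k)"
        using that by (rule pochhammer_product)
      moreover have "P \<le> norm (pochhammer (w y + of_nat k) (N - k))"
        using norm_pochhammer_ge_Re[of "w y + of_nat k" "N - k"] Re_w by (simp add: P_def)
      ultimately show ?thesis by (simp add: norm_mult mult.commute[of P] mult_left_mono)
    qed
    hence "norm (g y) * (P * norm (pochhammer (w y) k)) \<le> norm (g y) * norm (pochhammer (w y) N)" for y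
      by (intro mult_left_mono) auto
    hence "norm (g y * pochhammer (w y) k) \<le> norm (inverse P * norm (g y * pochhammer (w y) N))" for y
      using P by (simp add: norm_mult field_simps)
    hence "AE y in lborel. norm (g y * pochhammer (w y) k) \<le> norm (inverse P * norm (g y * pochhammer (w y) N))"
      by (intro AE_I2)
    thus ?thesis
    proof (rule Bochner_Integration.integrable_bound[rotated 2])
      show "integrable lborel (\<lambda>y. inverse P * norm (g y * pochhammer (w y) N))"
        by (intro integrable_mult_right integrable_norm int)
    qed measurable
  qed
  have int_H: "integrable lborel (H k x)" if "k \<le> N" "x > 0" for k x
  proof (rule Bochner_Integration.integrable_bound)
    show "integrable lborel (\<lambda>y. x powr (- \<omega> - real k) *\<^sub>R (g y * pochhammer (w y) k))"
      by (intro integrable_scaleR_right int_poch that)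
    show "AE y in lborel. norm (H k x y) \<le> norm (x powr (- \<omega> - real k) *\<^sub>R (g y * pochhammer (w y) k))"
      using that by (intro AE_I2) (simp add: H_def norm_mult norm_powr mult_ac)
  qed (simp add: H_def)
  have der_H: "((\<lambda>x. \<integral>y. H k x y \<partial>lborel) has_vector_derivative - (\<integral>y. H (Suc k) x0 y \<partial>lborel)) (at x0)"
    if k: "k < N" and x0: "x0 > 0" for k x0
  proof -
    define B where "B = (\<lambda>y. (x0 / 2) powr (- \<omega> - real (Suc k)) * norm (g y * pochhammer (w y) (Suc k)))"
    have "((\<lambda>x. \<integral>y. H k x y \<partial>lborel) has_vector_derivative (\<integral>y. - H (Suc k) x0 y \<partial>lborel)) (at x0)"
    proof (rule has_vector_derivative_integral_dominated[where r = "x0 / 2" and B = B and F' = "\<lambda>x y. - H (Suc k) x y"])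
      fix x assume "\<bar>x - x0\<bar> < x0 / 2"
      hence x: "x > x0 / 2" "x > 0" using x0 by (auto simp: abs_if split: if_splits)
      show "integrable lborel (H k x)" using k x by (intro int_H) auto
      fix y
      have "((\<lambda>x. g y * pochhammer (w y) k * complex_of_real x powr (- w y - of_nat k)) has_vector_derivative
          g y * pochhammer (w y) k * ((- w y - of_nat k) * complex_of_real x powr (- w y - of_nat k - 1))) (at x)"
        by (intro has_vector_derivative_mult_right has_vector_derivative_of_real_powr x)
      moreover have "g y * pochhammer (w y) k * ((- w y - of_nat k) * complex_of_real x powr (- w y - of_nat k - 1)) = - H (Suc k) x y"
        by (simp add: H_def pochhammer_rec' algebra_simps)
      ultimately show "((\<lambda>x. H k x y) has_vector_derivative - H (Suc k) x y) (at x)" by (simp add: H_def)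
      have "norm (- H (Suc k) x y) = x powr (- \<omega> - real (Suc k)) * norm (g y * pochhammer (w y) (Suc k))"
        unfolding norm_minus_cancel H_def norm_mult norm_powr[OF x(2)] by (simp add: mult_ac)
      also have "\<dots> \<le> B y"
        unfolding B_def using x x0 Re_w(2) by (intro mult_right_mono powr_mono2') auto
      finally show "norm (- H (Suc k) x y) \<le> B y" .
    next
      show "integrable lborel (\<lambda>y. - H (Suc k) x0 y)" using k x0 by (intro integrable_minus int_H) auto
      show "integrable lborel B" unfolding B_def using k by (intro integrable_mult_right integrable_norm int_poch) auto
    qed (use x0 in auto)
    thus ?thesis by simp
  qed
  have main: "k \<le> N \<Longrightarrow> \<forall>x>0. (neg_deriv ^^ k) J x = (\<integral>y. H k x y \<partial>lborel)" for k
  proof (induction k)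
    case 0
    thus ?case by (simp add: J H_def)
  next
    case (Suc k)
    show ?case
    proof (intro allI impI)
      fix x :: real assume x: "x > 0"
      have "((neg_deriv ^^ k) J has_vector_derivative - (\<integral>y. H (Suc k) x y \<partial>lborel)) (at x)"
        by (rule has_vector_derivative_transform_within_open[OF der_H, of _ _ "{0<..}"])
           (use Suc x in auto)
      from neg_deriv_eq[OF this] show "(neg_deriv ^^ Suc k) J x = (\<integral>y. H (Suc k) x y \<partial>lborel)" by simp
    qed
  qed
  show "k \<le> N \<Longrightarrow> x > 0 \<Longrightarrow> (neg_deriv ^^ k) J x =
           (\<integral>y. g y * pochhammer (w y) k * of_real x powr (- w y - of_nat k) \<partial>lborel)"
    using main[of k] by (simp add: H_def)
  show "(neg_deriv ^^ k) J differentiable (at x)" if "k < N" "x > 0"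
  proof -
    have "((neg_deriv ^^ k) J has_vector_derivative - (\<integral>y. H (Suc k) x y \<partial>lborel)) (at x)"
      by (rule has_vector_derivative_transform_within_open[OF der_H, of _ _ "{0<..}"])
         (use main[of k] that in auto)
    thus ?thesis by (auto simp: differentiable_def has_vector_derivative_def)
  qed
qed

section \<open>The Saigo integral of superpositions of powers\<close>

text \<open>
The eigenvalue of the Saigo integral on powers: it maps \<open>t\<^sup>-\<^sup>\<sigma>\<close> to this multiple of
\<open>x\<^sup>-\<^sup>\<beta>\<^sup>-\<^sup>\<sigma>\<close>.  The reciprocal Gamma function in the denominator makes it
meaningful also where the denominator has a pole.
\<close>

definition saigo_multiplier :: "complex \<Rightarrow> complex \<Rightarrow> complex \<Rightarrow> complex \<Rightarrow> complex" where
  "saigo_multiplier \<alpha> \<beta> \<gamma> \<sigma> = Gamma (\<beta> + \<sigma>) * Gamma (\<gamma> + \<sigma>) * rGamma \<sigma> * rGamma (\<alpha> + \<beta> + \<gamma> + \<sigma>)"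

lemma saigo_integral_power:
  assumes \<alpha>: "Re \<alpha> > 0" and \<beta>: "Re (\<beta> + \<sigma>) > 0" and \<gamma>: "Re (\<gamma> + \<sigma>) > 0" and x: "x > 0"
  shows "set_integrable lborel {x<..} (saigo_integrand \<alpha> \<beta> \<gamma> (\<lambda>t. of_real t powr (- \<sigma>)) x)"
    and "saigo_integral \<alpha> \<beta> \<gamma> (\<lambda>t. of_real t powr (- \<sigma>)) x =
      saigo_multiplier \<alpha> \<beta> \<gamma> \<sigma> * of_real x powr (- (\<beta> + \<sigma>))"
proof -
  define K where "K = (\<lambda>t. complex_of_real (t - x) powr (\<alpha> - 1) * of_real t powr (- \<alpha> - (\<beta> + \<sigma>)) *
    hyp2F1 (\<alpha> + \<beta>) (- \<gamma>) \<alpha> (of_real (1 - x / t)))"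
  have K: "saigo_integrand \<alpha> \<beta> \<gamma> (\<lambda>t. of_real t powr (- \<sigma>)) x t = K t" for t
  proof -
    have "complex_of_real t powr (- \<alpha> - (\<beta> + \<sigma>)) = of_real t powr (- \<alpha> - \<beta>) * of_real t powr (- \<sigma>)"
      unfolding powr_add[symmetric] by (simp add: algebra_simps)
    thus ?thesis unfolding saigo_integrand_def K_def by (simp only: mult_ac)
  qed
  have s: "Re (\<beta> + \<sigma> + \<alpha> - (\<alpha> + \<beta>) - (- \<gamma>)) > 0" using \<gamma> by simp
  note mellin = hypergeometric_kernel_mellin[OF \<alpha> \<beta> s x, folded K_def]
  show "set_integrable lborel {x<..} (saigo_integrand \<alpha> \<beta> \<gamma> (\<lambda>t. of_real t powr (- \<sigma>)) x)"
    using mellin(1) by (simp add: K set_integrable_def)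
  have "saigo_integral \<alpha> \<beta> \<gamma> (\<lambda>t. of_real t powr (- \<sigma>)) x = 1 / Gamma \<alpha> * (LINT t:{x<..}|lborel. K t)"
    by (simp add: saigo_integral_def K)
  also have "\<dots> = saigo_multiplier \<alpha> \<beta> \<gamma> \<sigma> * of_real x powr (- (\<beta> + \<sigma>))"
    unfolding mellin(2) saigo_multiplier_def using Re_pos_not_nonpos_Ints[OF \<alpha>]
    by (simp add: Gamma_eq_zero_iff algebra_simps)
  finally show "saigo_integral \<alpha> \<beta> \<gamma> (\<lambda>t. of_real t powr (- \<sigma>)) x =
      saigo_multiplier \<alpha> \<beta> \<gamma> \<sigma> * of_real x powr (- (\<beta> + \<sigma>))" .
qed

text \<open>
Along the contour the exponents \<open>\<rho> - i\<mu>y\<close> have constant real part, so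
\<open>|t\<^sup>i\<^sup>\<mu>\<^sup>y| = 1\<close>: the double integral of the modulus factors into the absolutely
convergent integral for the exponent \<open>\<rho>\<close> and that of \<open>|h|\<close>, and Fubini's theorem
applies.
\<close>

lemma saigo_integral_power_mixture:
  fixes h :: "real \<Rightarrow> complex" and \<mu> :: real
  assumes \<alpha>: "Re \<alpha> > 0" and \<beta>: "Re (\<beta> + \<rho>) > 0" and \<gamma>: "Re (\<gamma> + \<rho>) > 0" and x: "x > 0"
    and h: "integrable lborel h"
    and f: "\<And>t. t > 0 \<Longrightarrow> f t = (\<integral>y. h y * of_real t powr (- (\<rho> - \<i> * of_real (\<mu> * y))) \<partial>lborel)"
  shows "set_integrable lborel {x<..} (saigo_integrand \<alpha> \<beta> \<gamma> f x)"
    and "saigo_integral \<alpha> \<beta> \<gamma> f x = (\<integral>y. h y * saigo_multiplier \<alpha> \<beta> \<gamma> (\<rho> - \<i> * of_real (\<mu> * y)) *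
           of_real x powr (- (\<beta> + \<rho> - \<i> * of_real (\<mu> * y))) \<partial>lborel)"
proof -
  have [measurable]: "h \<in> borel_measurable borel" using h by auto
  define k where "k = (\<lambda>t. indicator {x<..} t *\<^sub>R saigo_integrand \<alpha> \<beta> \<gamma> (\<lambda>t. of_real t powr (- \<rho>)) x t)"
  define e where "e = (\<lambda>t y. exp (\<i> * of_real (\<mu> * y * ln t)))"
  define \<sigma> where "\<sigma> = (\<lambda>y. \<rho> - \<i> * of_real (\<mu> * y))"
  define \<Phi> where "\<Phi> = (\<lambda>t y. k t * (e t y * h y))"
  have k: "integrable lborel k"
    using saigo_integral_power(1)[OF \<alpha> \<beta> \<gamma> x] unfolding k_def set_integrable_def .
  have [measurable]: "k \<in> borel_measurable borel" using k by auto
  have [measurable]: "(\<lambda>(t, y). e t y) \<in> borel_measurable (borel \<Otimes>\<^sub>M borel)" unfolding e_def by measurable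
  have norm_e: "norm (e t y) = 1" for t y unfolding e_def by simp
  have powr_\<sigma>: "complex_of_real t powr (- \<sigma> y) = of_real t powr (- \<rho>) * e t y" if "t > 0" for t y
  proof -
    have "complex_of_real t powr (- \<sigma> y) = of_real t powr (- \<rho>) * of_real t powr (\<i> * of_real (\<mu> * y))"
      unfolding \<sigma>_def powr_add[symmetric] by simp
    also have "complex_of_real t powr (\<i> * of_real (\<mu> * y)) = e t y"
      using that by (simp add: powr_def e_def Ln_of_real mult_ac)
    finally show ?thesis .
  qed
  have int_eh: "integrable lborel (\<lambda>y. e t y * h y)" for t
    by (rule Bochner_Integration.integrable_bound[OF h]) (auto simp: norm_mult norm_e)
  have int_\<Phi>: "integrable (lborel \<Otimes>\<^sub>M lborel) (case_prod \<Phi>)"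
  proof (rule lborel_pair.Fubini_integrable)
    show "case_prod \<Phi> \<in> borel_measurable (lborel \<Otimes>\<^sub>M lborel)" unfolding \<Phi>_def by measurable
    have "(\<lambda>t. \<integral>y. norm (case_prod \<Phi> (t, y)) \<partial>lborel) = (\<lambda>t. norm (k t) * (\<integral>y. norm (h y) \<partial>lborel))"
      by (simp add: \<Phi>_def norm_mult norm_e)
    thus "integrable lborel (\<lambda>t. \<integral>y. norm (case_prod \<Phi> (t, y)) \<partial>lborel)"
      using k by simp
    show "AE t in lborel. integrable lborel (\<lambda>y. case_prod \<Phi> (t, y))"
      unfolding \<Phi>_def prod.case by (intro AE_I2 integrable_mult_right int_eh)
  qed
  have \<Phi>_y: "(\<integral>y. \<Phi> t y \<partial>lborel) = indicator {x<..} t *\<^sub>R saigo_integrand \<alpha> \<beta> \<gamma> f x t" for t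
  proof (cases "t > x")
    case True
    hence t: "t > 0" using x by simp
    have "f t = (\<integral>y. of_real t powr (- \<rho>) * (e t y * h y) \<partial>lborel)"
      unfolding f[OF t] using powr_\<sigma>[OF t] unfolding \<sigma>_def by (simp add: mult_ac)
    also have "\<dots> = of_real t powr (- \<rho>) * (\<integral>y. e t y * h y \<partial>lborel)" by (rule integral_mult_right_zero)
    finally have ft: "f t = of_real t powr (- \<rho>) * (\<integral>y. e t y * h y \<partial>lborel)" .
    have "(\<integral>y. \<Phi> t y \<partial>lborel) = k t * (\<integral>y. e t y * h y \<partial>lborel)"
      unfolding \<Phi>_def by (rule integral_mult_right_zero)
    thus ?thesis using True by (simp add: k_def saigo_integrand_def ft)
  qed (simp add: \<Phi>_def k_def)
  have G: "Gamma \<alpha> \<noteq> 0" using Re_pos_not_nonpos_Ints[OF \<alpha>] by (simp add: Gamma_eq_zero_iff)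
  have \<Phi>_t: "(\<integral>t. \<Phi> t y \<partial>lborel) = Gamma \<alpha> * (h y * saigo_multiplier \<alpha> \<beta> \<gamma> (\<sigma> y) * of_real x powr (- (\<beta> + \<sigma> y)))" for y
  proof -
    have "(\<integral>t. \<Phi> t y \<partial>lborel) = (LINT t:{x<..}|lborel. h y * saigo_integrand \<alpha> \<beta> \<gamma> (\<lambda>t. of_real t powr (- \<sigma> y)) x t)"
      unfolding set_lebesgue_integral_def
    proof (intro Bochner_Integration.integral_cong refl)
      fix t show "\<Phi> t y = indicator {x<..} t *\<^sub>R (h y * saigo_integrand \<alpha> \<beta> \<gamma> (\<lambda>t. of_real t powr (- \<sigma> y)) x t)"
        using x powr_\<sigma>[of t y] by (auto simp: indicator_def \<Phi>_def k_def saigo_integrand_def)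
    qed
    also have "\<dots> = h y * (LINT t:{x<..}|lborel. saigo_integrand \<alpha> \<beta> \<gamma> (\<lambda>t. of_real t powr (- \<sigma> y)) x t)"
      by (rule set_integral_mult_right)
    also have "\<dots> = h y * (Gamma \<alpha> * saigo_integral \<alpha> \<beta> \<gamma> (\<lambda>t. of_real t powr (- \<sigma> y)) x)"
      using G by (simp add: saigo_integral_def)
    also have "saigo_integral \<alpha> \<beta> \<gamma> (\<lambda>t. of_real t powr (- \<sigma> y)) x = saigo_multiplier \<alpha> \<beta> \<gamma> (\<sigma> y) * of_real x powr (- (\<beta> + \<sigma> y))"
      using \<alpha> \<beta> \<gamma> x by (intro saigo_integral_power(2)) (auto simp: \<sigma>_def)
    finally show ?thesis by (simp add: mult_ac)
  qed
  show "set_integrable lborel {x<..} (saigo_integrand \<alpha> \<beta> \<gamma> f x)"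
    using lborel_pair.integrable_fst[OF int_\<Phi>] unfolding \<Phi>_y set_integrable_def .
  have "saigo_integral \<alpha> \<beta> \<gamma> f x = 1 / Gamma \<alpha> * (\<integral>t. \<integral>y. \<Phi> t y \<partial>lborel \<partial>lborel)"
    unfolding saigo_integral_def set_lebesgue_integral_def \<Phi>_y ..
  also have "(\<integral>t. \<integral>y. \<Phi> t y \<partial>lborel \<partial>lborel) = (\<integral>y. \<integral>t. \<Phi> t y \<partial>lborel \<partial>lborel)"
    by (rule lborel_pair.Fubini_integral[OF int_\<Phi>, symmetric])
  also have "\<dots> = Gamma \<alpha> * (\<integral>y. h y * saigo_multiplier \<alpha> \<beta> \<gamma> (\<sigma> y) * of_real x powr (- (\<beta> + \<sigma> y)) \<partial>lborel)"
    unfolding \<Phi>_t by (rule integral_mult_right_zero)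
  finally show "saigo_integral \<alpha> \<beta> \<gamma> f x = (\<integral>y. h y * saigo_multiplier \<alpha> \<beta> \<gamma> (\<rho> - \<i> * of_real (\<mu> * y)) *
           of_real x powr (- (\<beta> + \<rho> - \<i> * of_real (\<mu> * y))) \<partial>lborel)"
    using G by (simp add: \<sigma>_def algebra_simps)
qed

section \<open>The Saigo derivative of the I-function\<close>

lemma integrable_I_integrand:
  assumes L: "gamma_log_branch L" and adm: "I_admissible m n us ls \<theta>"
  shows "integrable lborel (\<lambda>y. I_chi L m n us ls (\<i> * of_real y) * exp (- (\<i> * of_real y) * (of_real r + \<i> * of_real \<theta>)))"
proof -
  have "line_growth (I_Omega us ls) (I_Delta m n us ls) (\<lambda>y. I_chi L m n us ls (\<i> * of_real y))"
    using adm by (intro line_growth_I_chi L) (auto simp: I_admissible_def)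
  moreover have "(I_Delta m n us ls > 0 \<and> \<bar>\<theta>\<bar> < pi / 2 * I_Delta m n us ls) \<or>
      (\<bar>\<theta>\<bar> \<le> pi / 2 * I_Delta m n us ls \<and> I_Omega us ls < -1)"
    using adm by (auto simp: I_admissible_def I_abs_conv_def)
  ultimately have int: "integrable lborel (\<lambda>y. I_chi L m n us ls (\<i> * of_real y) * exp (of_real (\<theta> * y)))"
    by (rule integrable_line_growth)
  have eq: "I_chi L m n us ls (\<i> * of_real y) * exp (- (\<i> * of_real y) * (of_real r + \<i> * of_real \<theta>)) =
    (I_chi L m n us ls (\<i> * of_real y) * exp (of_real (\<theta> * y))) * exp (- \<i> * of_real (r * y))" for y
    by (simp add: algebra_simps flip: exp_add)
  show ?thesis unfolding eq
    by (rule Bochner_Integration.integrable_bound[OF int]) (use int in \<open>auto simp: norm_mult\<close>)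
qed

text \<open>
As a function of \<open>t\<close>, \<open>I[a t\<^sup>-\<^sup>\<mu>]\<close> is a superposition of the powers
\<open>t\<^sup>i\<^sup>\<mu>\<^sup>y\<close>.
\<close>

lemma I_fun_of_powr:
  assumes "a \<noteq> 0" "t > 0"
  shows "I_fun L m n us ls \<theta> (a * of_real (t powr (- \<mu>))) =
    (\<integral>y. (1 / (2 * of_real pi) * (I_chi L m n us ls (\<i> * of_real y) *
       exp (- (\<i> * of_real y) * (of_real (ln (norm a)) + \<i> * of_real \<theta>)))) * of_real t powr (\<i> * of_real (\<mu> * y)) \<partial>lborel)"
proof -
  have ln: "ln (norm (a * of_real (t powr (- \<mu>)))) = ln (norm a) - \<mu> * ln t"
    using assms by (simp add: norm_mult ln_mult ln_powr)
  have ex: "exp (- (\<i> * of_real y) * (of_real (ln (norm (a * of_real (t powr (- \<mu>))))) + \<i> * of_real \<theta>)) =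
    exp (- (\<i> * of_real y) * (of_real (ln (norm a)) + \<i> * of_real \<theta>)) * of_real t powr (\<i> * of_real (\<mu> * y))" for y
    unfolding ln using assms by (simp add: powr_def Ln_of_real algebra_simps flip: exp_add)
  show ?thesis
    unfolding I_fun_def ex by (subst integral_mult_right_zero[symmetric], intro Bochner_Integration.integral_cong) (auto simp: field_simps)
qed

lemma gamma_pow_1:
  assumes "gamma_log_branch L" "Re s = 0"
  shows "gamma_pow L 1 c d s = Gamma (c + of_real d * s)"
  using assms unfolding gamma_log_branch_def Let_def gamma_pow_def by (auto simp: Gamma_nonpos_Int)

text \<open>
The new factors have exponent \<open>1\<close>, so the branch of the logarithm drops out and they are
plain Gamma functions.  At a pole in the denominator both sides are \<open>0\<close>.
\<close>

lemma I_chi_extend: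
  assumes L: "gamma_log_branch L" and s: "Re s = 0" and m: "m \<le> length ls"
  shows "I_chi L m (n + 2) ((a, \<mu>, 1) # (a', \<mu>, 1) # us) (ls @ [(b, \<mu>, 1), (b', \<mu>, 1)]) s =
    I_chi L m n us ls s * (Gamma (1 - a - of_real \<mu> * s) * Gamma (1 - a' - of_real \<mu> * s) *
      rGamma (1 - b - of_real \<mu> * s) * rGamma (1 - b' - of_real \<mu> * s))"
  unfolding I_chi_def using m
  by (simp add: gamma_pow_1[OF L s] rGamma_inverse_Gamma divide_inverse mult_ac)

theorem corollary4p3:
  fixes L :: "real \<Rightarrow> complex \<Rightarrow> real \<Rightarrow> complex \<Rightarrow> complex"
    and m n :: nat and us ls :: "triple list"
    and \<alpha> \<beta> \<gamma> \<rho> a :: complex and \<mu> \<theta> :: real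
  defines "f \<equiv> \<lambda>t::real. of_real t powr (- \<rho>) * I_fun L m n us ls \<theta> (a * of_real (t powr (- \<mu>)))"
    and "us' \<equiv> (1 + \<beta> - \<rho>, \<mu>, 1) # (1 - \<alpha> - \<gamma> - \<rho>, \<mu>, 1) # us"
    and "ls' \<equiv> ls @ [(1 - \<rho>, \<mu>, 1), (1 + \<beta> - \<gamma> - \<rho>, \<mu>, 1)]"
  assumes "gamma_log_branch L"
    and "Re \<alpha> > 0"
    and "a \<noteq> 0" and "a = rcis (cmod a) \<theta>"
    and "\<mu> > 0"
    and "Re \<rho> > max (Re (- \<alpha> - \<gamma>)) (Re \<beta> + of_int \<lfloor>Re \<alpha>\<rfloor> + 1)"
    and "I_admissible m n us ls \<theta>"
    and "I_admissible m (n + 2) us' ls' \<theta>"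
  shows "saigo_deriv_defined \<alpha> \<beta> \<gamma> f \<and>
    (\<forall>x>0. saigo_deriv \<alpha> \<beta> \<gamma> f x =
       of_real x powr (\<beta> - \<rho>) * I_fun L m (n + 2) us' ls' \<theta> (a * of_real (x powr (- \<mu>))))"
proof -
  note L = assms(4) and \<alpha> = assms(5) and a = assms(6) and \<rho> = assms(9) and adm = assms(10) and adm' = assms(11)
  define N where "N = nat \<lfloor>Re \<alpha>\<rfloor> + 1"
  define \<alpha>' \<beta>' \<gamma>' where "\<alpha>' = - \<alpha> + of_nat N" and "\<beta>' = - \<beta> - of_nat N" and "\<gamma>' = \<alpha> + \<gamma>"
  define \<sigma> where "\<sigma> = (\<lambda>y. \<rho> - \<i> * of_real (\<mu> * y))"
  \<comment> \<open>the exponents after the fractional integral, before the \<open>N\<close> derivatives\<close>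
  define w where "w = (\<lambda>y. \<beta>' + \<sigma> y)"
  define E where "E = (\<lambda>y. exp (- (\<i> * of_real y) * (of_real (ln (norm a)) + \<i> * of_real \<theta>)))"
  define h where "h = (\<lambda>y. 1 / (2 * of_real pi) * (I_chi L m n us ls (\<i> * of_real y) * E y))"
  define h' where "h' = (\<lambda>y. 1 / (2 * of_real pi) * (I_chi L m (n + 2) us' ls' (\<i> * of_real y) * E y))"
  define G where "G = (\<lambda>y. saigo_multiplier \<alpha>' \<beta>' \<gamma>' (\<sigma> y))"
  define J where "J = saigo_integral \<alpha>' \<beta>' \<gamma>' f"
  have N: "real N = of_int \<lfloor>Re \<alpha>\<rfloor> + 1" using \<alpha> by (simp add: N_def)
  have Re\<alpha>': "Re \<alpha>' > 0" using N by (simp add: \<alpha>'_def)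
  have Re\<beta>': "Re (\<beta>' + \<rho>) > 0" using N \<rho> by (simp add: \<beta>'_def)
  have Re\<gamma>': "Re (\<gamma>' + \<rho>) > 0" using \<rho> by (simp add: \<gamma>'_def)
  have int_h: "integrable lborel h" unfolding h_def E_def
    by (intro integrable_mult_right integrable_I_integrand L adm)
  have int_h': "integrable lborel h'" unfolding h'_def E_def
    by (intro integrable_mult_right integrable_I_integrand L adm')
  have f_eq: "f t = (\<integral>y. h y * of_real t powr (- (\<rho> - \<i> * of_real (\<mu> * y))) \<partial>lborel)" if t: "t > 0" for t
  proof -
    have eq: "of_real t powr (- \<rho>) * (h y * of_real t powr (\<i> * of_real (\<mu> * y))) =
      h y * of_real t powr (- (\<rho> - \<i> * of_real (\<mu> * y)))" for y
      unfolding mult.left_commute[of _ "h y"] powr_add[symmetric] by simp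
    have "f t = (\<integral>y. of_real t powr (- \<rho>) * (h y * of_real t powr (\<i> * of_real (\<mu> * y))) \<partial>lborel)"
      unfolding f_def I_fun_of_powr[OF a t] h_def E_def by (rule integral_mult_right_zero[symmetric])
    thus ?thesis unfolding eq .
  qed
  have saigo_int: "set_integrable lborel {x<..} (saigo_integrand \<alpha>' \<beta>' \<gamma>' f x)"
    and J_eq: "J x = (\<integral>y. h y * G y * of_real x powr (- w y) \<partial>lborel)" if x: "x > 0" for x
    using saigo_integral_power_mixture[OF Re\<alpha>' Re\<beta>' Re\<gamma>' x int_h f_eq]
    by (simp_all add: J_def G_def w_def \<sigma>_def algebra_simps)
  \<comment> \<open>the \<open>N\<close> derivatives turn \<open>\<Gamma>(w)\<close> into \<open>\<Gamma>(w) (w)\<^sub>N = \<Gamma>(w + N)\<close>, and \<open>w + N = \<rho> - \<beta> - i\<mu>y\<close>\<close>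
  have hG: "h' y = h y * G y * pochhammer (w y) N" for y
  proof -
    have "w y \<notin> \<int>\<^sub>\<le>\<^sub>0" using Re\<beta>' by (intro Re_pos_not_nonpos_Ints) (simp add: w_def \<sigma>_def)
    hence "Gamma (w y) * pochhammer (w y) N = Gamma (w y + of_nat N)"
      by (simp add: pochhammer_Gamma Gamma_eq_zero_iff)
    moreover have "I_chi L m (n + 2) us' ls' (\<i> * of_real y) = I_chi L m n us ls (\<i> * of_real y) *
      (Gamma (w y + of_nat N) * Gamma (\<gamma>' + \<sigma> y) * rGamma (\<sigma> y) * rGamma (\<alpha>' + \<beta>' + \<gamma>' + \<sigma> y))"
      unfolding us'_def ls'_def using adm
      by (subst I_chi_extend[OF L]) (auto simp: I_admissible_def I_params_def w_def \<sigma>_def \<alpha>'_def \<beta>'_def \<gamma>'_def algebra_simps)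
    moreover have "\<beta>' + \<sigma> y = w y" by (simp add: w_def)
    ultimately show ?thesis
      unfolding h'_def h_def G_def saigo_multiplier_def by (simp add: mult_ac)
  qed
  have cont_shift: "continuous_on UNIV (\<lambda>y. z + \<sigma> y)" for z
    unfolding \<sigma>_def by (intro continuous_intros)
  have cont_Gamma: "continuous_on UNIV (\<lambda>y. Gamma (z + \<sigma> y))" if "Re (z + \<rho>) > 0" for z
  proof (rule continuous_on_compose2[OF continuous_on_Gamma[of "- \<int>\<^sub>\<le>\<^sub>0"] cont_shift])
    have "z + \<sigma> y \<notin> \<int>\<^sub>\<le>\<^sub>0" for y
      using that by (intro Re_pos_not_nonpos_Ints) (simp add: \<sigma>_def)
    thus "(\<lambda>y. z + \<sigma> y) ` UNIV \<subseteq> - \<int>\<^sub>\<le>\<^sub>0" by auto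
  qed auto
  have cont_rGamma: "continuous_on UNIV (\<lambda>y. rGamma (z + \<sigma> y))" for z
    by (rule continuous_on_compose2[OF continuous_on_rGamma[of UNIV] cont_shift]) simp
  have "continuous_on UNIV G"
    unfolding G_def saigo_multiplier_def using cont_rGamma[of 0]
    by (intro continuous_on_mult cont_Gamma cont_rGamma Re\<beta>' Re\<gamma>') simp
  hence [measurable]: "G \<in> borel_measurable borel" by (rule borel_measurable_continuous_onI)
  have [measurable]: "h \<in> borel_measurable borel" using int_h by auto
  have hG_meas: "(\<lambda>y. h y * G y) \<in> borel_measurable borel" by measurable
  have w_meas: "w \<in> borel_measurable borel" unfolding w_def \<sigma>_def by measurable
  have Re_w: "Re (w y) = Re (\<beta>' + \<rho>)" for y by (simp add: w_def \<sigma>_def)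
  have int_N: "integrable lborel (\<lambda>y. h y * G y * pochhammer (w y) N)" using int_h' unfolding hG[abs_def] .
  note deriv = neg_deriv_funpow_power_mixture[OF Re_w Re\<beta>' hG_meas w_meas int_N, of J]
  have deriv_N: "(neg_deriv ^^ N) J x = (\<integral>y. h' y * of_real x powr (- w y - of_nat N) \<partial>lborel)" if "x > 0" for x
    unfolding hG by (rule deriv(1)[OF J_eq]) (use that in simp_all)
  have deriv_differentiable: "(neg_deriv ^^ k) J differentiable (at x)" if "k < N" "x > 0" for k x
    by (rule deriv(2)[OF J_eq]) (use that in simp_all)
  have "saigo_deriv_defined \<alpha> \<beta> \<gamma> f"
    unfolding saigo_deriv_defined_def Let_def N_def[symmetric] \<alpha>'_def[symmetric]
      \<beta>'_def[symmetric] \<gamma>'_def[symmetric] J_def[symmetric]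
    by (intro allI impI conjI saigo_int deriv_differentiable)
  moreover have "saigo_deriv \<alpha> \<beta> \<gamma> f x =
       of_real x powr (\<beta> - \<rho>) * I_fun L m (n + 2) us' ls' \<theta> (a * of_real (x powr (- \<mu>)))" if x: "x > 0" for x
  proof -
    have "of_real x powr (- w y - of_nat N) = of_real x powr (\<beta> - \<rho>) * of_real x powr (\<i> * of_real (\<mu> * y))" for y
      unfolding powr_add[symmetric] by (simp add: w_def \<sigma>_def \<beta>'_def algebra_simps)
    hence eq: "h' y * of_real x powr (- w y - of_nat N) =
        of_real x powr (\<beta> - \<rho>) * (h' y * of_real x powr (\<i> * of_real (\<mu> * y)))" for y
      by (simp only: mult.left_commute)
    have "saigo_deriv \<alpha> \<beta> \<gamma> f x = (neg_deriv ^^ N) J x"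
      unfolding saigo_deriv_def Let_def N_def[symmetric] \<alpha>'_def[symmetric] \<beta>'_def[symmetric]
        \<gamma>'_def[symmetric] J_def[symmetric] ..
    also have "\<dots> = (\<integral>y. h' y * of_real x powr (- w y - of_nat N) \<partial>lborel)"
      by (rule deriv_N[OF x])
    also have "\<dots> = (\<integral>y. of_real x powr (\<beta> - \<rho>) * (h' y * of_real x powr (\<i> * of_real (\<mu> * y))) \<partial>lborel)"
      unfolding eq ..
    also have "\<dots> = of_real x powr (\<beta> - \<rho>) * (\<integral>y. h' y * of_real x powr (\<i> * of_real (\<mu> * y)) \<partial>lborel)"
      by (rule integral_mult_right_zero)
    finally show ?thesis unfolding I_fun_of_powr[OF a x] h'_def E_def .
  qed
  ultimately show ?thesis by blast
qed

end
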